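(* Let $\{X_i\}_{i\ge1}$ be a stationary sequence of real random variables with stationary distribution function $F$. For each $n$ let $X_{1,n}^\ast,\dots,X_{m_n,n}^\ast$ be a bootstrap sample (with no assumption on its structure), and let $$\mathbb{G}_n(t)=\frac{1}{\sqrt n}\sum_{i=1}^n\{1_{(-\infty,t]}(X_i)-F(t)\},\qquad \mathbb{G}_n^\ast(t)=\sqrt{m_n}\left(\frac1{m_n}\sum_{i=1}^{m_n}1_{(-\infty,t]}(X_{i,n}^\ast)-\frac1n\sum_{i=1}^n1_{(-\infty,t]}(X_i)\right),\quad t\in\mathbb{R}.$$ Let $T<\infty$ and $\mathcal{G}\subseteq BV_T'$. Assume that, conditionally on $X_1,\dots,X_n$, $\{\mathbb{G}_n^\ast(t),\ t\in\mathbb{R}\}$ converges weakly, in probability, to a Gaussian process that has uniformly continuous sample paths with respect to the distance $d(s,t)=|F(s)-F(t)|$. Then the following hold. (1) Conditionally on $X_1,\dots,X_n$, $\{\int g\,\mathrm{d}\mathbb{G}_n^\ast,\ g\in\mathcal{G}\}$ converges weakly, in probability, to a Gaussian process with uniformly $L_1(F)$-continuous sample paths in $\ell^\infty(\mathcal{G})$. (2) If the weak convergence of $\{\mathbb{G}_n^\ast(t),\ t\in\mathbb{R}\}$ holds almost surely, then the weak convergence of $\{\int g\,\mathrm{d}\mathbb{G}_n^\ast,\ g\in\mathcal{G}\}$ in $\ell^\infty(\mathcal{G})$ holds almost surely as well. (3) If $\{\mathbb{G}_n(t),\ t\in\mathbb{R}\}$ and $\{\mathbb{G}_n^\ast(t),\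 t\in\mathbb{R}\}$ converge weakly to the same limit, then so do $\{\int g\,\mathrm{d}\mathbb{G}_n,\ g\in\mathcal{G}\}$ and $\{\int g\,\mathrm{d}\mathbb{G}_n^\ast,\ g\in\mathcal{G}\}$.
   Context: For $g:\mathbb{R}\to\mathbb{R}$, $\|g\|_{TV}=\sup_{\Pi}\sum_{x_i,x_{i+1}\in\Pi}|g(x_{i+1})-g(x_i)|$, the supremum being over all countable partitions $\Pi=\{x_1<x_2<\dots\}$ of $\mathbb{R}$. For $T>0$, $BV_T=\{g:\mathbb{R}\to\mathbb{R}:\ \|g\|_{TV}\le T,\ \|g\|_\infty\le T\}$, and $BV_T'$ is the set of right-continuous functions in $BV_T$. $\ell^\infty(S)$ denotes the bounded real functions on $S$ with the supremum norm. Weak convergence is in the sense of Hoffmann-Jørgensen, with expectations (and probabilities) interpreted as outer ones where needed. For the bootstrap processes: given processes $\mathbb{Y}_n^\ast$ (depending on the bootstrap sample and on $X_1,\dots,X_n$) and $\mathbb{Y}$ with values in $\ell^\infty(S)$ ($S=\mathbb{R}$ or $S=\mathcal{G}$), put $d_{BL}(\mathbb{Y}_n^\ast,\mathbb{Y})=\sup_{h\in BL_1}|\mathbb{E}^\ast[h(\mathbb{Y}_n^\ast)]-\mathbb{E}[h(\mathbb{Y})]|$, where $\mathbb{E}^\ast$ is expectation over the randomness of the bootstrap sample conditionally given $X_1,\dots,X_n$, and $BL_1$ is the set of functionals $h:\ell^\infty(S)\to\mathbb{R}$ with $|h(x)|\le1$ and $|h(x)-h(y)|\le\|x-y\|_\infty$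 for all $x,y\in\ell^\infty(S)$. Conditional weak convergence of $\mathbb{Y}_n^\ast$ to $\mathbb{Y}$ holds in probability (respectively almost surely) if $d_{BL}(\mathbb{Y}_n^\ast,\mathbb{Y})\to0$ in probability (respectively almost surely). Weak convergence of $\mathbb{G}_n$ and of $\{\int g\,\mathrm{d}\mathbb{G}_n\}$ is ordinary (unconditional) weak convergence. "Uniformly $L_1(F)$-continuous" means uniformly continuous on $\mathcal{G}$ with respect to the semi-metric $(f,g)\mapsto\int|f-g|\,\mathrm{d}F$. *)

theory Defs
  imports "HOL-Probability.Probability"
begin

subsection \<open>Functions of bounded variation\<close>

text \<open>Points \<open>x 0 < x 1 < \<dots>\<close> of a countable partition; a finite partition can be
  prolonged to an infinite one, which does not decrease the sum.\<close>

definition tv_norm :: "(real \<Rightarrow> real) \<Rightarrow> ennreal" where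
  "tv_norm g = (SUP x \<in> {x :: nat \<Rightarrow> real. strict_mono x}. \<Sum>i. ennreal \<bar>g (x (Suc i)) - g (x i)\<bar>)"

definition BV :: "real \<Rightarrow> (real \<Rightarrow> real) set" where
  "BV T = {g. tv_norm g \<le> ennreal T \<and> (\<forall>x. \<bar>g x\<bar> \<le> T)}"

definition BV_rc :: "real \<Rightarrow> (real \<Rightarrow> real) set" where
  "BV_rc T = {g \<in> BV T. \<forall>x. continuous (at_right x) g}"


subsection \<open>The space of bounded functions and its bounded Lipschitz functionals\<close>

text \<open>Elements of \<open>linf S\<close> are extensional on \<open>S\<close>, so they are genuine functions on \<open>S\<close>.\<close>

definition linf :: "'s set \<Rightarrow> ('s \<Rightarrow> real) metric" where
  "linf S = funspace S euclidean_metric"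

definition linf_borel :: "'s set \<Rightarrow> ('s \<Rightarrow> real) measure" where
  "linf_borel S = sigma (mspace (linf S)) {U. openin (mtopology_of (linf S)) U}"

definition BL1 :: "'s set \<Rightarrow> (('s \<Rightarrow> real) \<Rightarrow> real) set" where
  "BL1 S = {h. (\<forall>x \<in> mspace (linf S). \<bar>h x\<bar> \<le> 1) \<and>
               (\<forall>x \<in> mspace (linf S). \<forall>y \<in> mspace (linf S). \<bar>h x - h y\<bar> \<le> mdist (linf S) x y)}"


subsection \<open>Weak convergence in the sense of Hoffmann-Joergensen\<close>

text \<open>Only used for bounded \<open>f\<close> on probability spaces, where it is harmless to
  restrict to integrable majorants.\<close>

definition outer_expectation :: "'a measure \<Rightarrow> ('a \<Rightarrow> real) \<Rightarrow> real" where
  "outer_expectation M f =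
     Inf {integral\<^sup>L M U | U. integrable M U \<and> (\<forall>\<omega> \<in> space M. f \<omega> \<le> U \<omega>)}"

definition weakly_converges ::
    "'s set \<Rightarrow> 'a measure \<Rightarrow> (nat \<Rightarrow> 'a \<Rightarrow> 's \<Rightarrow> real) \<Rightarrow> 'b measure \<Rightarrow> ('b \<Rightarrow> 's \<Rightarrow> real) \<Rightarrow> bool" where
  "weakly_converges S M Yn N Y \<longleftrightarrow>
     (\<forall>h. continuous_map (mtopology_of (linf S)) euclideanreal h \<and> bounded (h ` mspace (linf S)) \<longrightarrow>
        (\<lambda>n. outer_expectation M (\<lambda>\<omega>. h (Yn n \<omega>))) \<longlonglongrightarrow> (LINT \<omega>|N. h (Y \<omega>)))"

definition d_BL ::
    "'s set \<Rightarrow> 'c measure \<Rightarrow> ('c \<Rightarrow> 's \<Rightarrow> real) \<Rightarrow> 'b measure \<Rightarrow> ('b \<Rightarrow> 's \<Rightarrow> real) \<Rightarrow> real" where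
  "d_BL S K Z N Y =
     (SUP h \<in> BL1 S. \<bar>outer_expectation K (\<lambda>v. h (Z v)) - (LINT \<omega>|N. h (Y \<omega>))\<bar>)"

definition tends_to_0_in_outer_prob :: "'a measure \<Rightarrow> (nat \<Rightarrow> 'a \<Rightarrow> real) \<Rightarrow> bool" where
  "tends_to_0_in_outer_prob M D \<longleftrightarrow>
     (\<forall>\<epsilon>>0. (\<lambda>n. outer_measure_of M {\<omega> \<in> space M. \<bar>D n \<omega>\<bar> > \<epsilon>}) \<longlonglongrightarrow> 0)"


subsection \<open>Gaussian processes\<close>

text \<open>Degenerate normal laws are allowed.\<close>

definition gaussian_rv :: "'b measure \<Rightarrow> ('b \<Rightarrow> real) \<Rightarrow> bool" where
  "gaussian_rv N Z \<longleftrightarrow> Z \<in> borel_measurable N \<and>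
     ((\<exists>\<mu>. AE \<omega> in N. Z \<omega> = \<mu>) \<or>
      (\<exists>\<mu> \<sigma>. \<sigma> > 0 \<and> distributed N lborel Z (normal_density \<mu> \<sigma>)))"

definition gaussian_process :: "'b measure \<Rightarrow> 's set \<Rightarrow> ('b \<Rightarrow> 's \<Rightarrow> real) \<Rightarrow> bool" where
  "gaussian_process N S Y \<longleftrightarrow>
     (\<forall>I a. finite I \<and> I \<subseteq> S \<longrightarrow> gaussian_rv N (\<lambda>\<omega>. \<Sum>s\<in>I. a s * Y \<omega> s))"

definition semimetric_uniformly_continuous ::
    "'s set \<Rightarrow> ('s \<Rightarrow> 's \<Rightarrow> real) \<Rightarrow> ('s \<Rightarrow> real) \<Rightarrow> bool" where
  "semimetric_uniformly_continuous S d z \<longleftrightarrow>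
     (\<forall>\<epsilon>>0. \<exists>\<delta>>0. \<forall>s\<in>S. \<forall>t\<in>S. d s t < \<delta> \<longrightarrow> \<bar>z s - z t\<bar> < \<epsilon>)"

text \<open>A Gaussian process on \<open>(S, d)\<close> with uniformly continuous paths, viewed as a Borel random
  element of \<open>linf S\<close> (as required of limits in weak convergence).\<close>

definition uc_gaussian_process ::
    "'s set \<Rightarrow> ('s \<Rightarrow> 's \<Rightarrow> real) \<Rightarrow> 'b measure \<Rightarrow> ('b \<Rightarrow> 's \<Rightarrow> real) \<Rightarrow> bool" where
  "uc_gaussian_process S d N Y \<longleftrightarrow>
     prob_space N \<and> Y \<in> N \<rightarrow>\<^sub>M linf_borel S \<and> gaussian_process N S Y \<and>
     (\<forall>\<omega> \<in> space N. semimetric_uniformly_continuous S d (Y \<omega>))"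


subsection \<open>Stationary sequences and conditional distributions\<close>

definition stationary_sequence :: "'a measure \<Rightarrow> (nat \<Rightarrow> 'a \<Rightarrow> real) \<Rightarrow> bool" where
  "stationary_sequence M X \<longleftrightarrow>
     (\<forall>i\<ge>1. X i \<in> borel_measurable M) \<and>
     (\<forall>k. distr M (Pi\<^sub>M {1..} (\<lambda>_. borel)) (\<lambda>\<omega>. \<lambda>i\<in>{1..}. X (i + k) \<omega>) =
          distr M (Pi\<^sub>M {1..} (\<lambda>_. borel)) (\<lambda>\<omega>. \<lambda>i\<in>{1..}. X i \<omega>))"

text \<open>\<open>\<kappa>\<close> is a regular version of the conditional distribution of \<open>V\<close> given \<open>U\<close>.\<close>

definition regular_cond_distr ::
    "'a measure \<Rightarrow> 'u measure \<Rightarrow> 'v measure \<Rightarrow> ('a \<Rightarrow> 'u) \<Rightarrow> ('a \<Rightarrow> 'v) \<Rightarrow> ('u \<Rightarrow> 'v measure) \<Rightarrow> bool" where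
  "regular_cond_distr M A B U V \<kappa> \<longleftrightarrow>
     \<kappa> \<in> A \<rightarrow>\<^sub>M prob_algebra B \<and>
     (\<forall>C \<in> sets A. \<forall>D \<in> sets B.
        emeasure M {\<omega> \<in> space M. U \<omega> \<in> C \<and> V \<omega> \<in> D} =
        (\<integral>\<^sup>+\<omega>. indicator C (U \<omega>) * emeasure (\<kappa> (U \<omega>)) D \<partial>M))"

definition sample :: "(nat \<Rightarrow> 'a \<Rightarrow> real) \<Rightarrow> nat \<Rightarrow> 'a \<Rightarrow> nat \<Rightarrow> real" where
  "sample X n \<omega> = (\<lambda>i\<in>{1..n}. X i \<omega>)"


subsection \<open>Empirical and bootstrap processes\<close>

definition ecdf :: "nat \<Rightarrow> (nat \<Rightarrow> real) \<Rightarrow> real \<Rightarrow> real" where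
  "ecdf n x t = (1 / real n) * (\<Sum>i=1..n. indicat_real {..t} (x i))"

definition emp_process :: "nat \<Rightarrow> (real \<Rightarrow> real) \<Rightarrow> (nat \<Rightarrow> real) \<Rightarrow> real \<Rightarrow> real" where
  "emp_process n F x t = (1 / sqrt (real n)) * (\<Sum>i=1..n. indicat_real {..t} (x i) - F t)"

definition boot_process :: "nat \<Rightarrow> nat \<Rightarrow> (nat \<Rightarrow> real) \<Rightarrow> (nat \<Rightarrow> real) \<Rightarrow> real \<Rightarrow> real" where
  "boot_process n m x y t =
     sqrt (real m) * ((1 / real m) * (\<Sum>i=1..m. indicat_real {..t} (y i))
                    - (1 / real n) * (\<Sum>i=1..n. indicat_real {..t} (x i)))"

text \<open>Lebesgue-Stieltjes integral with respect to a distribution function; it is extended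
  linearly to the two processes, which are multiples of differences of distribution functions.\<close>

definition ls_integral :: "(real \<Rightarrow> real) \<Rightarrow> (real \<Rightarrow> real) \<Rightarrow> real" where
  "ls_integral H g = (LINT x|interval_measure H. g x)"

lemma emp_process_eq:
  "n > 0 \<Longrightarrow> emp_process n F x t = sqrt (real n) * (ecdf n x t - F t)"
  by (simp add: emp_process_def ecdf_def sum_subtractf field_simps flip: real_sqrt_mult)

lemma boot_process_eq:
  "boot_process n m x y t = sqrt (real m) * (ecdf m y t - ecdf n x t)"
  by (simp add: boot_process_def ecdf_def)

definition emp_integral ::
    "(real \<Rightarrow> real) set \<Rightarrow> nat \<Rightarrow> (real \<Rightarrow> real) \<Rightarrow> (nat \<Rightarrow> real) \<Rightarrow> (real \<Rightarrow> real) \<Rightarrow> real" where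
  "emp_integral \<G> n F x =
     (\<lambda>g\<in>\<G>. sqrt (real n) * (ls_integral (ecdf n x) g - ls_integral F g))"

definition boot_integral ::
    "(real \<Rightarrow> real) set \<Rightarrow> nat \<Rightarrow> nat \<Rightarrow> (nat \<Rightarrow> real) \<Rightarrow> (nat \<Rightarrow> real) \<Rightarrow> (real \<Rightarrow> real) \<Rightarrow> real" where
  "boot_integral \<G> n m x y =
     (\<lambda>g\<in>\<G>. sqrt (real m) * (ls_integral (ecdf m y) g - ls_integral (ecdf n x) g))"

lemma ls_integral_ecdf:
  assumes n: "n > 0" and g: "g \<in> borel_measurable borel"
  shows "ls_integral (ecdf n x) g = (1 / real n) * (\<Sum>i=1..n. g (x i))"
proof -
  define Q where "Q = distr (measure_pmf (pmf_of_set {1..n})) borel x"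
  have ne: "{1..n} \<noteq> {}" and fin: "finite {1..n}" using n by auto
  have Q: "real_distribution Q"
    unfolding Q_def real_distribution_def real_distribution_axioms_def
    by (auto intro!: prob_space.prob_space_distr measure_pmf.prob_space_axioms)
  interpret Q: real_distribution Q by (rule Q)
  have cdfQ: "cdf Q = ecdf n x"
  proof
    fix t
    have "cdf Q t = measure (measure_pmf (pmf_of_set {1..n})) {i. x i \<le> t}"
      unfolding cdf_def Q_def by (subst measure_distr) (auto simp: vimage_def)
    also have "\<dots> = real (card ({1..n} \<inter> {i. x i \<le> t})) / real n"
      using measure_pmf_of_set[OF ne fin] by simp
    also have "real (card ({1..n} \<inter> {i. x i \<le> t})) = (\<Sum>i\<in>{1..n}. indicat_real {i. x i \<le> t} i)"
      by (simp add: sum.If_cases indicator_def of_bool_def Int_def)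
    finally show "cdf Q t = ecdf n x t"
      by (simp add: ecdf_def indicator_def)
  qed
  have rd: "real_distribution (interval_measure (cdf Q))"
    by (rule real_distribution_interval_measure)
       (use Q.cdf_nondecreasing Q.cdf_is_right_cont Q.cdf_lim_at_bot Q.cdf_lim_at_top_prob in auto)
  have "cdf (interval_measure (cdf Q)) = cdf Q"
    by (intro ext cdf_interval_measure)
       (use Q.cdf_nondecreasing Q.cdf_is_right_cont Q.cdf_lim_at_bot Q.cdf_lim_at_top_prob in auto)
  then have "interval_measure (ecdf n x) = Q"
    using cdf_unique[OF rd Q] cdfQ by simp
  then have "ls_integral (ecdf n x) g = (LINT i|measure_pmf (pmf_of_set {1..n}). g (x i))"
    unfolding ls_integral_def Q_def using g by (simp add: integral_distr)
  also have "\<dots> = (1 / real n) * (\<Sum>i=1..n. g (x i))"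
    using integral_pmf_of_set[OF ne fin, of "\<lambda>i. g (x i)"] by simp
  finally show ?thesis .
qed

end

theory Submission
  imports Defs
begin

text \<open>
  For \<open>g \<in> BV T\<close> the Riemann-Stieltjes sums of \<open>g\<close> against a bounded \<open>z\<close> are, by summation by
  parts, bounded by \<open>3 T\<close> times the supremum norm of \<open>z\<close>. Their upper limit thus defines a Lipschitz
  map from \<open>linf UNIV\<close> to \<open>linf \<G>\<close>. By right-continuity of \<open>g\<close> and dominated convergence, it sends
  the empirical and bootstrap processes to their integral versions, so both modes of convergence
  carry over to the image \<open>Z\<close> of the limit \<open>Y\<close>.

  A path of \<open>Y\<close> is uniformly approximated by functions \<open>\<psi> \<circ> F\<close> with \<open>\<psi>\<close> Lipschitz. For these the sums
  converge and are Lipschitz in \<open>g\<close> with respect to \<open>L\<^sub>1(F)\<close>, whence the uniform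
  continuity of the paths of \<open>Z\<close>. The finite linear combinations of \<open>Z\<close> are pointwise limits of finite
  linear combinations of \<open>Y\<close>, hence Gaussian.
\<close>

subsection \<open>Riemann-Stieltjes sums\<close>

text \<open>Runs from \<open>- Suc k\<close> in steps of \<open>1 / Suc k\<close>; it refines and
  exhausts the line as \<open>k\<close> grows. The index \<open>j\<close> is unbounded so that each
  grid is an infinite partition as in \<open>tv_norm\<close>.\<close>

definition grid :: "nat \<Rightarrow> nat \<Rightarrow> real" where
  "grid k j = real j / real (Suc k) - real (Suc k)"

text \<open>The index at which the grid reaches \<open>Suc k\<close>.\<close>

definition grid_size :: "nat \<Rightarrow> nat" where
  "grid_size k = 2 * (Suc k)^2"

text \<open>The integrand is taken at right end points, which fits right-continuous \<open>g\<close>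
  and the half-open cells charged by \<open>interval_measure\<close>.\<close>

definition rs_sum :: "nat \<Rightarrow> (real \<Rightarrow> real) \<Rightarrow> (real \<Rightarrow> real) \<Rightarrow> real" where
  "rs_sum k z g = (\<Sum>j<grid_size k. g (grid k (Suc j)) * (z (grid k (Suc j)) - z (grid k j)))"

definition step_approx :: "nat \<Rightarrow> (real \<Rightarrow> real) \<Rightarrow> real \<Rightarrow> real" where
  "step_approx k g x =
     (\<Sum>j<grid_size k. g (grid k (Suc j)) * indicat_real {grid k j<..grid k (Suc j)} x)"

text \<open>Just what makes the step approximations converge boundedly. Unlike
  \<open>BV_rc T\<close>, it passes to \<open>\<bar>f - g\<bar>\<close> at once, with the bound
  doubled.\<close>

definition rc_bounded :: "real \<Rightarrow> (real \<Rightarrow> real) \<Rightarrow> bool" where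
  "rc_bounded B g \<longleftrightarrow> (\<forall>x. continuous (at_right x) g) \<and> (\<forall>x. \<bar>g x\<bar> \<le> B)"

section \<open>Grid cells and pointwise convergence of the step approximations\<close>

lemma strict_mono_grid: "strict_mono (grid k)"
  by (auto simp: strict_mono_def grid_def divide_strict_right_mono)

lemma grid_le: "grid k j \<le> grid k (Suc j)"
  by (auto simp: grid_def divide_simps)

text \<open>Scaling by \<open>Suc k\<close> turns the cells into unit intervals with integer end
  points, open on the left, and the ceiling tells these apart. Hence each point lies in at most one
  cell.\<close>

lemma mem_grid_cell_iff:
  "x \<in> {grid k j<..grid k (Suc j)} \<longleftrightarrow> \<lceil>x * real (Suc k)\<rceil> = int (Suc j) - int ((Suc k)^2)"
proof -
  have p: "real (Suc k) > 0" by simp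
  have e: "grid k j = (real j - real (Suc k) ^ 2) / real (Suc k)" for j
    using p by (simp add: grid_def field_simps power2_eq_square)
  have "x \<in> {grid k j<..grid k (Suc j)} \<longleftrightarrow>
      real j - real (Suc k) ^ 2 < x * real (Suc k) \<and> x * real (Suc k) \<le> real (Suc j) - real (Suc k) ^ 2"
    unfolding e greaterThanAtMost_iff pos_divide_less_eq[OF p] pos_le_divide_eq[OF p] by simp
  also have "\<dots> \<longleftrightarrow> \<lceil>x * real (Suc k)\<rceil> = int (Suc j) - int ((Suc k)^2)"
    by (auto simp: ceiling_eq_iff)
  finally show ?thesis .
qed

lemma step_approx_eq:
  assumes "\<bar>x\<bar> < real (Suc k)"
  shows "step_approx k g x = g (\<lceil>x * real (Suc k)\<rceil> / real (Suc k))"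
proof -
  define c where "c = \<lceil>x * real (Suc k)\<rceil>"
  define K where "K = int ((Suc k)^2)"
  have p: "real (Suc k) > 0" by simp
  have KK: "real_of_int K = real (Suc k) * real (Suc k)"
    unfolding K_def by (simp add: power2_eq_square algebra_simps)
  have "x * real (Suc k) < real_of_int K"
    unfolding KK by (intro mult_strict_right_mono) (use assms in auto)
  then have c1: "c \<le> K" unfolding c_def by linarith
  have "- real (Suc k) * real (Suc k) < x * real (Suc k)"
    by (intro mult_strict_right_mono) (use assms in auto)
  then have c2: "- K < c" unfolding c_def using KK mult_minus_left[of "real (Suc k)" "real (Suc k)"] by linarith
  \<comment> \<open>The cell index solves \<open>Suc i = c + K\<close>; \<open>- K < c\<close> keeps
    \<open>nat\<close> from truncating.\<close>
  define i where "i = nat (c + K - 1)"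
  have i: "int (Suc i) = c + K" using c2 by (simp add: i_def)
  have il: "i < grid_size k"
  proof -
    have "int (grid_size k) = 2 * K" by (simp add: grid_size_def K_def)
    then show ?thesis using c1 i by linarith
  qed
  have ind: "indicat_real {grid k j<..grid k (Suc j)} x = (if j = i then 1 else 0)" for j
    using mem_grid_cell_iff[of x k j] i by (auto simp: indicator_def c_def K_def)
  have "step_approx k g x = (\<Sum>j<grid_size k. if j = i then g (grid k (Suc j)) else 0)"
    unfolding step_approx_def ind by (intro sum.cong) auto
  also have "\<dots> = g (grid k (Suc i))" using il by simp
  also have "grid k (Suc i) = c / real (Suc k)"
  proof -
    have "real (Suc i) = real_of_int (c + K)" using i by (metis of_int_of_nat_eq)
    then have "grid k (Suc i) = (real_of_int c + real (Suc k) * real (Suc k)) / real (Suc k) - real (Suc k)"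
      unfolding grid_def by (simp only: of_int_add KK)
    also have "\<dots> = c / real (Suc k)" using p by (simp add: add_divide_distrib del: of_nat_Suc)
    finally show ?thesis .
  qed
  finally show ?thesis by (simp add: c_def)
qed

text \<open>At most one indicator is nonzero, so the value is a value of \<open>g\<close> or
  0.\<close>

lemma step_approx_le:
  assumes "\<And>x. \<bar>g x\<bar> \<le> B"
  shows "\<bar>step_approx k g x\<bar> \<le> B"
proof (cases "\<exists>j<grid_size k. x \<in> {grid k j<..grid k (Suc j)}")
  case True
  then obtain i where i: "i < grid_size k" "x \<in> {grid k i<..grid k (Suc i)}" by auto
  then have ind: "indicat_real {grid k j<..grid k (Suc j)} x = (if j = i then 1 else 0)" for j
    using mem_grid_cell_iff[of x k j] mem_grid_cell_iff[of x k i] unfolding indicator_def by force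
  have "step_approx k g x = (\<Sum>j<grid_size k. if j = i then g (grid k (Suc j)) else 0)"
    unfolding step_approx_def ind by (intro sum.cong) auto
  then show ?thesis using i assms by simp
next
  case False
  then have "step_approx k g x = 0" unfolding step_approx_def by (intro sum.neutral) auto
  moreover have "0 \<le> B" using assms[of 0] by linarith
  ultimately show ?thesis by simp
qed

text \<open>Once the grid covers \<open>x\<close>, the approximation is \<open>g\<close> at a point
  of \<open>[x, x + 1 / Suc k]\<close>; these points tend to \<open>x\<close> from the
  right.\<close>

lemma step_approx_LIMSEQ:
  assumes "continuous (at_right x) g"
  shows "(\<lambda>k. step_approx k g x) \<longlonglongrightarrow> g x"
proof -
  let ?r = "\<lambda>k. \<lceil>x * real (Suc k)\<rceil> / real (Suc k)"
  have r1: "x \<le> ?r k" for k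
    using le_of_int_ceiling[of "x * real (Suc k)"] by (simp add: pos_le_divide_eq del: of_nat_Suc)
  have r2: "?r k \<le> x + 1 / real (Suc k)" for k
  proof -
    have "real_of_int \<lceil>x * real (Suc k)\<rceil> \<le> x * real (Suc k) + 1" by linarith
    then have "?r k \<le> (x * real (Suc k) + 1) / real (Suc k)" by (intro divide_right_mono) auto
    also have "\<dots> = x + 1 / real (Suc k)" by (simp add: add_divide_distrib del: of_nat_Suc)
    finally show ?thesis .
  qed
  have "(\<lambda>k. x + 1 / real (Suc k)) \<longlonglongrightarrow> x + 0"
    by (intro tendsto_intros LIMSEQ_Suc[OF lim_1_over_n])
  then have rl: "?r \<longlonglongrightarrow> x"
    by (intro tendsto_sandwich[of "\<lambda>_. x" ?r sequentially "\<lambda>k. x + 1 / real (Suc k)"])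
       (use r1 r2 in auto)
  \<comment> \<open>The evaluation points may equal \<open>x\<close>, so continuity is needed within
    the closed half-line.\<close>
  have "continuous (at x within {x..}) g"
  proof -
    have "{x..} - {x} = {x<..} - {x}" by auto
    then have "at x within {x..} = at_right x" by (simp only: at_within_def)
    then show ?thesis using assms by simp
  qed
  then have "(\<lambda>k. g (?r k)) \<longlonglongrightarrow> g x"
    using rl r1 by (auto simp: continuous_within_sequentially o_def)
  moreover have "eventually (\<lambda>k. step_approx k g x = g (?r k)) sequentially"
  proof -
    obtain n :: nat where "\<bar>x\<bar> < real n" using reals_Archimedean2 by blast
    then show ?thesis
      by (intro eventually_sequentiallyI[of n] step_approx_eq) auto
  qed
  ultimately show ?thesis using filterlim_cong by force
qed

lemma borel_measurable_step_approx [measurable]: "step_approx k g \<in> borel_measurable borel"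
  unfolding step_approx_def[abs_def] by measurable

lemma right_continuous_borel_measurable:
  fixes g :: "real \<Rightarrow> real"
  assumes "\<And>x. continuous (at_right x) g"
  shows "g \<in> borel_measurable borel"
  by (rule borel_measurable_LIMSEQ_real[OF step_approx_LIMSEQ[OF assms]]) auto

lemma rc_bounded_abs_diff:
  assumes "rc_bounded B f" "rc_bounded B g"
  shows "rc_bounded (2 * B) (\<lambda>x. \<bar>f x - g x\<bar>)"
proof -
  have "\<bar>f x - g x\<bar> \<le> 2 * B" for x
    using assms abs_triangle_ineq4[of "f x" "g x"] unfolding rc_bounded_def
    by (smt (verit, best))
  then show ?thesis using assms unfolding rc_bounded_def
    by (auto intro!: continuous_intros)
qed

section \<open>Linearity and bounds of the sums\<close>

lemma rs_sum_diff_left: "rs_sum k (\<lambda>t. z t - w t) g = rs_sum k z g - rs_sum k w g"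
  by (simp add: rs_sum_def algebra_simps sum_subtractf sum.distrib)

lemma rs_sum_diff_right: "rs_sum k z (\<lambda>t. f t - g t) = rs_sum k z f - rs_sum k z g"
  by (simp add: rs_sum_def algebra_simps sum_subtractf sum.distrib)

lemma rs_sum_cmult_left: "rs_sum k (\<lambda>t. c * z t) g = c * rs_sum k z g"
  by (simp add: rs_sum_def algebra_simps sum_distrib_left)

lemma rs_sum_sum_left: "rs_sum k (\<lambda>t. \<Sum>i\<in>I. z i t) g = (\<Sum>i\<in>I. rs_sum k (z i) g)"
  unfolding rs_sum_def sum_subtractf[symmetric] sum_distrib_left by (rule sum.swap)

text \<open>As a function of \<open>t\<close> the indicator jumps at \<open>y\<close> only, so just
  the cell containing \<open>y\<close> contributes. This reduces empirical distribution functions to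
  step approximations at the data.\<close>

lemma rs_sum_indicator: "rs_sum k (\<lambda>t. indicat_real {..t} y) g = step_approx k g y"
  unfolding rs_sum_def step_approx_def
  by (intro sum.cong arg_cong2[where f=times] refl) (use grid_le in \<open>auto simp: indicator_def intro: order_trans\<close>)

text \<open>The whole grid is one of the partitions in \<open>tv_norm\<close>, and a partial sum is
  at most the series.\<close>

lemma BV_grid_variation:
  assumes "g \<in> BV T" "T \<ge> 0"
  shows "(\<Sum>j<n. \<bar>g (grid k (Suc j)) - g (grid k j)\<bar>) \<le> T"
proof -
  have "ennreal (\<Sum>j<n. \<bar>g (grid k (Suc j)) - g (grid k j)\<bar>) =
      (\<Sum>j<n. ennreal \<bar>g (grid k (Suc j)) - g (grid k j)\<bar>)"
    by (simp add: sum_ennreal)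
  also have "\<dots> \<le> (\<Sum>j. ennreal \<bar>g (grid k (Suc j)) - g (grid k j)\<bar>)"
    by (intro sum_le_suminf) auto
  also have "\<dots> \<le> tv_norm g"
    unfolding tv_norm_def by (rule SUP_upper) (use strict_mono_grid in simp)
  also have "\<dots> \<le> ennreal T" using assms by (simp add: BV_def)
  finally show ?thesis using assms by (simp add: ennreal_le_iff)
qed

lemma summation_by_parts:
  fixes a b :: "nat \<Rightarrow> real"
  shows "(\<Sum>j<n. a (Suc j) * (b (Suc j) - b j)) =
     a n * b n - a 0 * b 0 - (\<Sum>j<n. (a (Suc j) - a j) * b j)"
  by (induction n) (simp_all add: algebra_simps)

text \<open>Summation by parts moves the differences onto \<open>g\<close>: each of the two boundary
  terms costs at most \<open>T * b\<close>, and so does the variation of \<open>g\<close> against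
  \<open>z\<close>. The bound does not depend on \<open>k\<close>.\<close>

lemma rs_sum_le:
  assumes g: "g \<in> BV T" and T: "T \<ge> 0" and z: "\<And>t. \<bar>z t\<bar> \<le> b"
  shows "\<bar>rs_sum k z g\<bar> \<le> 3 * T * b"
proof -
  have b: "0 \<le> b" using z[of 0] by linarith
  let ?a = "\<lambda>j. g (grid k j)" and ?b = "\<lambda>j. z (grid k j)" and ?n = "grid_size k"
  have p: "\<bar>?a i * ?b i\<bar> \<le> T * b" for i
    unfolding abs_mult by (intro mult_mono) (use g z T in \<open>auto simp: BV_def\<close>)
  have "\<bar>\<Sum>j<?n. (?a (Suc j) - ?a j) * ?b j\<bar> \<le> (\<Sum>j<?n. \<bar>?a (Suc j) - ?a j\<bar> * b)"
    by (rule order_trans[OF sum_abs]) (intro sum_mono, simp add: abs_mult mult_left_mono z)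
  also have "\<dots> = (\<Sum>j<?n. \<bar>?a (Suc j) - ?a j\<bar>) * b" by (simp add: sum_distrib_right)
  also have "\<dots> \<le> T * b" by (intro mult_right_mono BV_grid_variation g T b)
  finally have "\<bar>\<Sum>j<?n. (?a (Suc j) - ?a j) * ?b j\<bar> \<le> T * b" .
  moreover have "rs_sum k z g = ?a ?n * ?b ?n - ?a 0 * ?b 0 - (\<Sum>j<?n. (?a (Suc j) - ?a j) * ?b j)"
    unfolding rs_sum_def using summation_by_parts[of ?a ?b] by simp
  ultimately show ?thesis using p[of ?n] p[of 0] by linarith
qed

text \<open>The increments of \<open>H\<close> are the masses of the cells, so the sum is the
  integral of \<open>step_approx k g\<close>. Dominated convergence applies because a bounded
  \<open>H\<close> gives a finite measure.\<close>

lemma rs_sum_LIMSEQ_interval_measure: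
  assumes mono: "\<And>s t. s \<le> t \<Longrightarrow> H s \<le> H t" and rc: "\<And>t. continuous (at_right t) H"
    and bdd: "\<And>t. \<bar>H t\<bar> \<le> C" and g: "rc_bounded B g"
  shows "(\<lambda>k. rs_sum k H g) \<longlonglongrightarrow> ls_integral H g"
proof -
  let ?\<mu> = "interval_measure H"
  \<comment> \<open>Total mass at most \<open>2 * C\<close>, by exhaustion with bounded
    intervals.\<close>
  have "emeasure ?\<mu> UNIV = (SUP i. emeasure ?\<mu> {- real i<..real i})"
    by (subst SUP_emeasure_incseq) (auto simp: incseq_def UN_Ioc_eq_UNIV)
  also have "\<dots> \<le> ennreal (2 * C)"
    using bdd by (intro SUP_least) (auto simp: emeasure_interval_measure_Ioc mono rc intro!: ennreal_leI,
       smt (verit))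
  finally have fin: "finite_measure ?\<mu>"
    by (intro finite_measureI) (auto simp: top_unique)
  interpret finite_measure ?\<mu> by (rule fin)
  have g': "\<And>x. continuous (at_right x) g" "\<And>x. \<bar>g x\<bar> \<le> B" using g by (auto simp: rc_bounded_def)
  have [measurable]: "g \<in> borel_measurable borel" by (intro right_continuous_borel_measurable g')
  have "rs_sum k H g = (LINT x|?\<mu>. step_approx k g x)" for k
    unfolding rs_sum_def step_approx_def
    by (subst Bochner_Integration.integral_sum)
       (auto simp: measure_interval_measure_Ioc grid_le mono rc emeasure_interval_measure_Ioc
         intro!: integrable_mult_right integrable_real_indicator)
  moreover have "(\<lambda>k. LINT x|?\<mu>. step_approx k g x) \<longlonglongrightarrow> (LINT x|?\<mu>. g x)"
  proof (rule integral_dominated_convergence[where w="\<lambda>_. B"])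
    show "AE x in ?\<mu>. (\<lambda>k. step_approx k g x) \<longlonglongrightarrow> g x"
      using step_approx_LIMSEQ g' by auto
    show "AE x in ?\<mu>. norm (step_approx k g x) \<le> B" for k
      using step_approx_le g' by auto
  qed auto
  ultimately show ?thesis by (simp add: ls_integral_def)
qed

text \<open>Both sides are averages over the sample, of \<open>step_approx k g\<close> and of
  \<open>g\<close>.\<close>

lemma rs_sum_LIMSEQ_ecdf:
  assumes "n > 0" "rc_bounded B g"
  shows "(\<lambda>k. rs_sum k (ecdf n x) g) \<longlonglongrightarrow> ls_integral (ecdf n x) g"
proof -
  have g: "\<And>x. continuous (at_right x) g" using assms by (auto simp: rc_bounded_def)
  have "rs_sum k (ecdf n x) g = (1 / real n) * (\<Sum>i=1..n. step_approx k g (x i))" for k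
    unfolding ecdf_def[abs_def] rs_sum_cmult_left rs_sum_sum_left rs_sum_indicator ..
  then show ?thesis
    using assms by (auto simp: ls_integral_ecdf right_continuous_borel_measurable[OF g]
        intro!: tendsto_intros step_approx_LIMSEQ g)
qed

subsection \<open>Bounded functions and outer expectations\<close>

lemma mspace_linf: "z \<in> mspace (linf S) \<longleftrightarrow> z \<in> extensional S \<and> (\<exists>B. \<forall>s\<in>S. \<bar>z s\<bar> \<le> B)"
proof -
  have "bounded (z ` S) \<longleftrightarrow> (\<exists>B. \<forall>s\<in>S. \<bar>z s\<bar> \<le> B)" by (auto simp: bounded_iff)
  then show ?thesis
    by (simp add: linf_def Met_TC.fspace_def)
qed

lemma mdist_linf_upper:
  assumes "z \<in> mspace (linf S)" "w \<in> mspace (linf S)" "s \<in> S"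
  shows "\<bar>z s - w s\<bar> \<le> mdist (linf S) z w"
proof -
  have z: "z \<in> Met_TC.fspace S" "w \<in> Met_TC.fspace S" using assms by (simp_all add: linf_def)
  then have "dist (z s) (w s) \<le> (SUP u\<in>S. dist (z u) (w u))"
    using assms(3) by (intro cSUP_upper Met_TC.bdd_above_dist) auto
  then show ?thesis
    using assms(3) z by (auto simp: linf_def Met_TC.fdist_def dist_real_def)
qed

text \<open>The condition \<open>0 \<le> c\<close> covers the cases where the distance takes its
  default value 0, such as empty \<open>S\<close>.\<close>

lemma mdist_linf_least:
  assumes "0 \<le> c" "\<And>s. s \<in> S \<Longrightarrow> \<bar>z s - w s\<bar> \<le> c"
  shows "mdist (linf S) z w \<le> c"
  using assms by (auto simp: linf_def Met_TC.fdist_def dist_real_def intro!: cSUP_least)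

section \<open>Outer expectations of bounded functions and the bounded Lipschitz distance\<close>

lemma outer_expectation_cong:
  "(\<And>\<omega>. \<omega> \<in> space M \<Longrightarrow> f \<omega> = g \<omega>) \<Longrightarrow> outer_expectation M f = outer_expectation M g"
  unfolding outer_expectation_def by simp

text \<open>The constant \<open>B\<close> is a majorant and every majorant has integral at least
  \<open>- B\<close>, so the infimum is over a nonempty set that is bounded below.\<close>

lemma (in prob_space) outer_expectation_abs_le:
  assumes "\<And>\<omega>. \<omega> \<in> space M \<Longrightarrow> \<bar>f \<omega>\<bar> \<le> B"
  shows "\<bar>outer_expectation M f\<bar> \<le> B"
proof -
  let ?S = "{integral\<^sup>L M U | U. integrable M U \<and> (\<forall>\<omega> \<in> space M. f \<omega> \<le> U \<omega>)}"
  have B: "B \<in> ?S"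
    by (rule CollectI, rule exI[of _ "\<lambda>_. B"]) (use assms in \<open>force simp: prob_space\<close>)
  have lb: "- B \<le> x" if "x \<in> ?S" for x
  proof -
    from that obtain U where U: "x = integral\<^sup>L M U" "integrable M U" "\<forall>\<omega> \<in> space M. f \<omega> \<le> U \<omega>" by auto
    have "integral\<^sup>L M (\<lambda>_. - B) \<le> integral\<^sup>L M U"
      by (rule integral_mono) (use U assms in force)+
    then show ?thesis using U by (simp add: prob_space)
  qed
  have "Inf ?S \<le> B" by (rule cInf_lower[OF B]) (use lb in \<open>auto intro!: bdd_belowI[of _ "-B"]\<close>)
  moreover have "- B \<le> Inf ?S" by (rule cInf_greatest) (use B lb in auto)
  ultimately show ?thesis unfolding outer_expectation_def by auto
qed

lemma (in prob_space) outer_expectation_cmult: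
  assumes c: "c > 0" and f: "\<And>\<omega>. \<omega> \<in> space M \<Longrightarrow> \<bar>f \<omega>\<bar> \<le> B"
  shows "outer_expectation M (\<lambda>\<omega>. c * f \<omega>) = c * outer_expectation M f"
proof -
  \<comment> \<open>Dividing a majorant of \<open>d * u\<close> by \<open>d\<close> gives one of
    \<open>u\<close>. The reverse inequality is this one for the factor \<open>inverse c\<close>,
    whence the general \<open>d\<close> and \<open>u\<close>.\<close>
  have le: "d * outer_expectation M u \<le> outer_expectation M (\<lambda>\<omega>. d * u \<omega>)"
    if d: "d > 0" and u: "\<And>\<omega>. \<omega> \<in> space M \<Longrightarrow> \<bar>u \<omega>\<bar> \<le> b" for d u b
    unfolding outer_expectation_def[of _ "\<lambda>\<omega>. d * u \<omega>"]
  proof (rule cInf_greatest)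
    have "integrable M (\<lambda>\<omega>. d * b) \<and> (\<forall>\<omega> \<in> space M. d * u \<omega> \<le> d * b)"
      using d u by (force intro!: mult_left_mono)
    then show "{integral\<^sup>L M U | U. integrable M U \<and> (\<forall>\<omega> \<in> space M. d * u \<omega> \<le> U \<omega>)} \<noteq> {}"
      by blast
  next
    fix x assume "x \<in> {integral\<^sup>L M U | U. integrable M U \<and> (\<forall>\<omega> \<in> space M. d * u \<omega> \<le> U \<omega>)}"
    then obtain U where U: "x = integral\<^sup>L M U" "integrable M U" "\<forall>\<omega> \<in> space M. d * u \<omega> \<le> U \<omega>" by auto
    let ?S = "{integral\<^sup>L M U | U. integrable M U \<and> (\<forall>\<omega> \<in> space M. u \<omega> \<le> U \<omega>)}"
    have "integral\<^sup>L M (\<lambda>\<omega>. U \<omega> / d) \<in> ?S"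
      by (rule CollectI, rule exI[of _ "\<lambda>\<omega>. U \<omega> / d"])
         (use U d in \<open>auto simp: pos_le_divide_eq mult.commute\<close>)
    moreover have "bdd_below ?S"
    proof (rule bdd_belowI[of _ "-b"], safe)
      fix V assume V: "integrable M V" "\<forall>\<omega> \<in> space M. u \<omega> \<le> V \<omega>"
      have "integral\<^sup>L M (\<lambda>_. - b) \<le> integral\<^sup>L M V"
        by (rule integral_mono) (use V u in force)+
      then show "- b \<le> integral\<^sup>L M V" by (simp add: prob_space)
    qed
    ultimately have "outer_expectation M u \<le> integral\<^sup>L M (\<lambda>\<omega>. U \<omega> / d)"
      unfolding outer_expectation_def by (rule cInf_lower)
    then show "d * outer_expectation M u \<le> x"
      using d U by (simp add: pos_le_divide_eq mult.commute)
  qed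
  have "outer_expectation M f = outer_expectation M (\<lambda>\<omega>. inverse c * (c * f \<omega>))"
    using c by (intro outer_expectation_cong) simp
  have cf: "\<bar>c * f \<omega>\<bar> \<le> c * B" if "\<omega> \<in> space M" for \<omega>
    using c f[OF that] by (simp add: abs_mult)
  moreover have "inverse c * outer_expectation M (\<lambda>\<omega>. c * f \<omega>) \<le>
      outer_expectation M (\<lambda>\<omega>. inverse c * (c * f \<omega>))"
    by (rule le[OF _ cf]) (use c in auto)
  ultimately have "outer_expectation M (\<lambda>\<omega>. c * f \<omega>) \<le> c * outer_expectation M f"
    using c by (simp add: field_simps)
  moreover have "c * outer_expectation M f \<le> outer_expectation M (\<lambda>\<omega>. c * f \<omega>)"
    by (rule le[OF c]) (rule f)
  ultimately show ?thesis by simp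
qed

text \<open>A function that is not integrable has integral 0 by convention, which
  \<open>B \<ge> 0\<close> keeps within the bound.\<close>

lemma (in prob_space) integral_abs_le:
  fixes f :: "'a \<Rightarrow> real"
  assumes "\<And>\<omega>. \<omega> \<in> space M \<Longrightarrow> \<bar>f \<omega>\<bar> \<le> B" "B \<ge> 0"
  shows "\<bar>integral\<^sup>L M f\<bar> \<le> B"
proof (cases "integrable M f")
  case True
  have "\<bar>integral\<^sup>L M f\<bar> \<le> integral\<^sup>L M (\<lambda>x. \<bar>f x\<bar>)" by (rule integral_abs_bound)
  also have "\<dots> \<le> integral\<^sup>L M (\<lambda>_. B)"
    by (rule integral_mono) (use True assms in auto)
  finally show ?thesis by (simp add: prob_space)
qed (use assms in \<open>simp add: not_integrable_integral_eq\<close>)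

text \<open>Makes the real-valued \<open>SUP\<close> in \<open>d_BL\<close> a genuine supremum: both
  expectations lie in \<open>[-1, 1]\<close>.\<close>

lemma bdd_above_BL1:
  assumes K: "prob_space K" and N: "prob_space N"
    and Z: "\<And>v. v \<in> space K \<Longrightarrow> Z v \<in> mspace (linf S)"
    and Y: "\<And>\<omega>. \<omega> \<in> space N \<Longrightarrow> Y \<omega> \<in> mspace (linf S)"
  shows "bdd_above ((\<lambda>h. \<bar>outer_expectation K (\<lambda>v. h (Z v)) - (LINT \<omega>|N. h (Y \<omega>))\<bar>) ` BL1 S)"
proof (rule bdd_aboveI2)
  fix h assume h: "h \<in> BL1 S"
  have "\<bar>outer_expectation K (\<lambda>v. h (Z v))\<bar> \<le> 1"
    by (rule prob_space.outer_expectation_abs_le[OF K]) (use h Z in \<open>auto simp: BL1_def\<close>)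
  moreover have "\<bar>LINT \<omega>|N. h (Y \<omega>)\<bar> \<le> 1"
    by (rule prob_space.integral_abs_le[OF N]) (use h Y in \<open>auto simp: BL1_def\<close>)
  ultimately show "\<bar>outer_expectation K (\<lambda>v. h (Z v)) - (LINT \<omega>|N. h (Y \<omega>))\<bar> \<le> 2" by linarith
qed

lemma zero_in_BL1: "(\<lambda>_. 0) \<in> BL1 S"
  by (auto simp: BL1_def)

lemma d_BL_nonneg:
  assumes "prob_space K" "prob_space N"
    "\<And>v. v \<in> space K \<Longrightarrow> Z v \<in> mspace (linf S)"
    "\<And>\<omega>. \<omega> \<in> space N \<Longrightarrow> Y \<omega> \<in> mspace (linf S)"
  shows "0 \<le> d_BL S K Z N Y"
  unfolding d_BL_def
  by (rule cSUP_upper2[OF bdd_above_BL1[OF assms] zero_in_BL1]) auto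

text \<open>For \<open>h\<close> in \<open>BL1 S'\<close>, the functional \<open>h \<circ> L\<close>
  divided by \<open>C\<close> lies in \<open>BL1 S\<close>: the division cancels the Lipschitz
  constant, and \<open>C \<ge> 1\<close> preserves the bound 1. Scaling back costs the factor
  \<open>C\<close>.\<close>

lemma d_BL_Lipschitz_map:
  assumes K: "prob_space K" and N: "prob_space N"
    and Z: "\<And>v. v \<in> space K \<Longrightarrow> Z v \<in> mspace (linf S)"
    and Y: "\<And>\<omega>. \<omega> \<in> space N \<Longrightarrow> Y \<omega> \<in> mspace (linf S)"
    and L: "\<And>z. z \<in> mspace (linf S) \<Longrightarrow> L z \<in> mspace (linf S')"
    and Lip: "\<And>z w. z \<in> mspace (linf S) \<Longrightarrow> w \<in> mspace (linf S) \<Longrightarrow>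
        mdist (linf S') (L z) (L w) \<le> C * mdist (linf S) z w"
    and C: "C \<ge> 1"
  shows "d_BL S' K (\<lambda>v. L (Z v)) N (\<lambda>\<omega>. L (Y \<omega>)) \<le> C * d_BL S K Z N Y"
  unfolding d_BL_def[of S']
proof (rule cSUP_least)
  show "BL1 S' \<noteq> {}" using zero_in_BL1 by auto
next
  fix h assume h: "h \<in> BL1 S'"
  define h' where "h' z = h (L z) / C" for z
  have h': "h' \<in> BL1 S"
    unfolding BL1_def
  proof (safe)
    fix z assume z: "z \<in> mspace (linf S)"
    then have "\<bar>h (L z)\<bar> \<le> 1" using h L by (auto simp: BL1_def)
    then show "\<bar>h' z\<bar> \<le> 1" using C by (simp add: h'_def field_simps)
    fix w assume w: "w \<in> mspace (linf S)"
    have "\<bar>h (L z) - h (L w)\<bar> \<le> C * mdist (linf S) z w"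
      using h L[OF z] L[OF w] Lip[OF z w] unfolding BL1_def by fastforce
    then show "\<bar>h' z - h' w\<bar> \<le> mdist (linf S) z w"
      using C by (simp add: h'_def diff_divide_distrib[symmetric] pos_divide_le_eq mult.commute)
  qed
  have hC: "h (L z) = C * h' z" for z using C by (simp add: h'_def)
  have "outer_expectation K (\<lambda>v. h (L (Z v))) = C * outer_expectation K (\<lambda>v. h' (Z v))"
    unfolding hC
    by (rule prob_space.outer_expectation_cmult[OF K, where B=1]) (use C h' Z in \<open>auto simp: BL1_def\<close>)
  then have "\<bar>outer_expectation K (\<lambda>v. h (L (Z v))) - (LINT \<omega>|N. h (L (Y \<omega>)))\<bar> =
      C * \<bar>outer_expectation K (\<lambda>v. h' (Z v)) - (LINT \<omega>|N. h' (Y \<omega>))\<bar>"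
    using C unfolding hC by (simp add: right_diff_distrib[symmetric] abs_mult)
  also have "\<dots> \<le> C * d_BL S K Z N Y"
    unfolding d_BL_def
    by (intro mult_left_mono cSUP_upper h' bdd_above_BL1[OF K N Z Y]) (use C in auto)
  finally show "\<bar>outer_expectation K (\<lambda>v. h (L (Z v))) - (LINT \<omega>|N. h (L (Y \<omega>)))\<bar> \<le> C * d_BL S K Z N Y" .
qed

section \<open>Borel sets of the spaces of bounded functions\<close>

lemma space_linf_borel [simp]: "space (linf_borel S) = mspace (linf S)"
  unfolding linf_borel_def using openin_subset[of "mtopology_of (linf S)"]
  by (intro space_measure_of) auto

lemma continuous_map_linf_borel_measurable:
  assumes "continuous_map (mtopology_of (linf S)) (mtopology_of (linf S')) L"
  shows "L \<in> linf_borel S \<rightarrow>\<^sub>M linf_borel S'"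
proof -
  have sub: "{U. openin (mtopology_of (linf S)) U} \<subseteq> Pow (mspace (linf S))" for S :: "'c set"
    using openin_subset[of "mtopology_of (linf S)"] by auto
  show ?thesis
    unfolding linf_borel_def[of S']
  proof (rule measurable_sigma_sets[OF _ sub])
    show "sets (sigma (mspace (linf S')) {U. openin (mtopology_of (linf S')) U}) =
      sigma_sets (mspace (linf S')) {U. openin (mtopology_of (linf S')) U}"
      using sub by (rule sets_measure_of)
    show "L \<in> space (linf_borel S) \<rightarrow> mspace (linf S')"
      using continuous_map_funspace[OF assms] by simp
    fix U assume "U \<in> {U. openin (mtopology_of (linf S')) U}"
    then have "openin (mtopology_of (linf S)) {x \<in> mspace (linf S). L x \<in> U}"
      using openin_continuous_map_preimage[OF assms] by simp
    moreover have "L -` U \<inter> space (linf_borel S) = {x \<in> mspace (linf S). L x \<in> U}"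
      by auto
    ultimately show "L -` U \<inter> space (linf_borel S) \<in> sets (linf_borel S)"
      by (auto simp: linf_borel_def sets_measure_of[OF sub])
  qed
qed

subsection \<open>Limits of Gaussian random variables\<close>

text \<open>Reflection about \<open>\<mu>\<close> preserves the law, so the two probabilities agree;
  their events cover the space.\<close>

lemma (in prob_space) normal_median:
  assumes X: "distributed M lborel X (normal_density \<mu> \<sigma>)" and \<sigma>: "\<sigma> > 0"
  shows "prob {\<omega> \<in> space M. X \<omega> \<ge> \<mu>} \<ge> 1/2" "prob {\<omega> \<in> space M. X \<omega> \<le> \<mu>} \<ge> 1/2"
proof -
  have X': "distributed M lborel (\<lambda>x. 2 * \<mu> + (-1) * X x) (normal_density \<mu> \<sigma>)"
    using normal_density_affine[OF X \<sigma>, of "-1" "2 * \<mu>"] by simp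
  have [measurable]: "X \<in> borel_measurable M"
    using distributed_measurable[OF X] by simp
  have "distr M lborel X = distr M lborel (\<lambda>x. 2 * \<mu> + (-1) * X x)"
    using distributed_distr_eq_density[OF X] distributed_distr_eq_density[OF X'] by simp
  then have "measure (distr M lborel X) {\<mu>..} = measure (distr M lborel (\<lambda>x. 2 * \<mu> + (-1) * X x)) {\<mu>..}"
    by simp
  also have "measure (distr M lborel X) {\<mu>..} = prob {\<omega> \<in> space M. X \<omega> \<ge> \<mu>}"
    by (subst measure_distr) (auto intro!: arg_cong[where f=prob])
  also have "measure (distr M lborel (\<lambda>x. 2 * \<mu> + (-1) * X x)) {\<mu>..} = prob {\<omega> \<in> space M. X \<omega> \<le> \<mu>}"
    by (subst measure_distr) (auto intro!: arg_cong[where f=prob])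
  finally have eq: "prob {\<omega> \<in> space M. X \<omega> \<ge> \<mu>} = prob {\<omega> \<in> space M. X \<omega> \<le> \<mu>}" .
  have "1 = prob ({\<omega> \<in> space M. X \<omega> \<ge> \<mu>} \<union> {\<omega> \<in> space M. X \<omega> \<le> \<mu>})"
    unfolding prob_space[symmetric] by (rule arg_cong[where f=prob]) auto
  also have "\<dots> \<le> prob {\<omega> \<in> space M. X \<omega> \<ge> \<mu>} + prob {\<omega> \<in> space M. X \<omega> \<le> \<mu>}"
    by (rule measure_Un_le) auto
  finally show "prob {\<omega> \<in> space M. X \<omega> \<ge> \<mu>} \<ge> 1/2" "prob {\<omega> \<in> space M. X \<omega> \<le> \<mu>} \<ge> 1/2"
    using eq by auto
qed

text \<open>The density is at most \<open>1 / \<sigma>\<close>, since \<open>2 * pi \<ge> 1\<close>,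
  and the interval has length \<open>2 * B\<close>.\<close>

lemma (in prob_space) normal_small_ball:
  assumes X: "distributed M lborel X (normal_density \<mu> \<sigma>)" and \<sigma>: "\<sigma> > 0" and B: "B \<ge> 0"
  shows "prob {\<omega> \<in> space M. \<bar>X \<omega>\<bar> \<le> B} \<le> 2 * B / \<sigma>"
proof -
  have d: "normal_density \<mu> \<sigma> x \<le> 1 / \<sigma>" for x
  proof -
    have "sqrt (2 * pi * \<sigma>\<^sup>2) = sqrt (2 * pi) * \<sigma>" using \<sigma> by (simp add: real_sqrt_mult)
    moreover have "1 \<le> sqrt (2 * pi)" using pi_gt3 by simp
    ultimately have s: "\<sigma> \<le> sqrt (2 * pi * \<sigma>\<^sup>2)" using \<sigma> mult_right_mono[of 1 "sqrt (2*pi)" \<sigma>] by simp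
    have "normal_density \<mu> \<sigma> x \<le> 1 / sqrt (2 * pi * \<sigma>\<^sup>2) * 1"
      unfolding normal_density_def by (intro mult_left_mono) (auto simp: \<sigma>)
    also have "\<dots> \<le> 1 / \<sigma>" using s \<sigma> by (simp add: frac_le)
    finally show ?thesis .
  qed
  have "emeasure M (X -` {-B..B} \<inter> space M) =
      (\<integral>\<^sup>+x. ennreal (normal_density \<mu> \<sigma> x) * indicator {-B..B} x \<partial>lborel)"
    by (rule distributed_emeasure[OF X]) simp
  also have "\<dots> \<le> (\<integral>\<^sup>+x. ennreal (1 / \<sigma>) * indicator {-B..B} x \<partial>lborel)"
    by (intro nn_integral_mono mult_right_mono ennreal_leI d) auto
  also have "\<dots> = ennreal (1 / \<sigma>) * ennreal (2 * B)"
    using B by (subst nn_integral_cmult_indicator) auto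
  also have "\<dots> = ennreal (2 * B / \<sigma>)" using \<sigma> B by (simp add: ennreal_mult[symmetric])
  finally have "emeasure M (X -` {-B..B} \<inter> space M) \<le> ennreal (2 * B / \<sigma>)" .
  moreover have "X -` {-B..B} \<inter> space M = {\<omega> \<in> space M. \<bar>X \<omega>\<bar> \<le> B}" by auto
  ultimately show ?thesis using B \<sigma> by (simp add: emeasure_eq_measure)
qed

lemma (in prob_space) char_normal:
  assumes X: "distributed M lborel X (normal_density \<mu> \<sigma>)" and \<sigma>: "\<sigma> > 0"
  shows "char (distr M borel X) t = iexp (\<mu> * t) * complex_of_real (exp (- ((\<sigma> * t)^2) / 2))"
proof -
  let ?U = "\<lambda>x. (X x - \<mu>) / \<sigma>"
  have [measurable]: "X \<in> borel_measurable M"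
    using distributed_measurable[OF X] by simp
  have U: "distributed M lborel ?U std_normal_density"
    using X \<sigma> normal_standard_normal_convert by blast
  have "distr M borel ?U = distr M lborel ?U" by (rule distr_cong) auto
  also have "\<dots> = std_normal_distribution" using distributed_distr_eq_density[OF U] .
  finally have cU: "char (distr M borel ?U) s = complex_of_real (exp (- (s^2) / 2))" for s
    using char_std_normal_distribution by simp
  have "char (distr M borel X) t = (CLINT x|M. iexp (t * X x))"
    unfolding char_def by (subst integral_distr) auto
  also have "\<dots> = (CLINT x|M. iexp (\<mu> * t) * iexp ((\<sigma> * t) * ?U x))"
  proof (rule Bochner_Integration.integral_cong[OF refl])
    fix x
    have "t * X x = \<mu> * t + (\<sigma> * t) * ?U x" using \<sigma> by (simp add: field_simps)
    then show "iexp (t * X x) = iexp (\<mu> * t) * iexp ((\<sigma> * t) * ?U x)"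
      by (simp only: of_real_add distrib_left exp_add)
  qed
  also have "\<dots> = iexp (\<mu> * t) * (CLINT x|M. iexp ((\<sigma> * t) * ?U x))" by simp
  also have "(CLINT x|M. iexp ((\<sigma> * t) * ?U x)) = char (distr M borel ?U) (\<sigma> * t)"
    unfolding char_def by (subst integral_distr) auto
  finally show ?thesis using cU by simp
qed

text \<open>Treats degenerate and proper normal laws alike, a constant having
  \<open>\<sigma> = 0\<close>; hence the small-ball bound is multiplied out by
  \<open>\<sigma>\<close>. The last three facts serve to bound the parameters under
  tightness.\<close>

lemma (in prob_space) gaussian_rv_char:
  assumes "gaussian_rv M X"
  obtains \<mu> \<sigma> where "\<sigma> \<ge> 0" "\<And>t. char (distr M borel X) t = iexp (\<mu> * t) * complex_of_real (exp (- ((\<sigma> * t)^2) / 2))"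
    "prob {\<omega> \<in> space M. X \<omega> \<ge> \<mu>} \<ge> 1/2" "prob {\<omega> \<in> space M. X \<omega> \<le> \<mu>} \<ge> 1/2"
    "\<And>B. B \<ge> 0 \<Longrightarrow> \<sigma> * prob {\<omega> \<in> space M. \<bar>X \<omega>\<bar> \<le> B} \<le> 2 * B"
proof -
  have [measurable]: "X \<in> borel_measurable M" using assms by (simp add: gaussian_rv_def)
  from assms consider \<mu> where "AE \<omega> in M. X \<omega> = \<mu>"
    | \<mu> \<sigma> where "\<sigma> > 0" "distributed M lborel X (normal_density \<mu> \<sigma>)"
    unfolding gaussian_rv_def by auto
  then show thesis
  proof cases
    case 1
    have "char (distr M borel X) t = iexp (\<mu> * t)" for t
    proof -
      have "char (distr M borel X) t = (CLINT x|M. iexp (t * X x))"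
        unfolding char_def by (subst integral_distr) auto
      also have "\<dots> = (CLINT x|M. iexp (t * \<mu>))"
        using 1 by (intro integral_cong_AE) auto
      finally show ?thesis by (simp add: prob_space mult.commute)
    qed
    moreover have "prob {\<omega> \<in> space M. X \<omega> \<ge> \<mu>} = 1" "prob {\<omega> \<in> space M. X \<omega> \<le> \<mu>} = 1"
      using 1 by (subst prob_Collect_eq_1; auto)+
    ultimately show thesis by (intro that[of 0 \<mu>]) auto
  next
    case 2
    have "\<sigma> * prob {\<omega> \<in> space M. \<bar>X \<omega>\<bar> \<le> B} \<le> 2 * B" if "B \<ge> 0" for B
      using normal_small_ball[OF 2(2,1) that] 2(1) by (simp add: pos_le_divide_eq mult.commute)
    then show thesis
      using normal_median[OF 2(2,1)] char_normal[OF 2(2,1)] 2(1) by (intro that[of \<sigma> \<mu>]) auto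
  qed
qed

text \<open>By Levy uniqueness: the law is compared with that of a constant if
  \<open>\<sigma> = 0\<close>, and with the normal law otherwise.\<close>

lemma (in prob_space) gaussian_rv_if_char:
  assumes [measurable]: "X \<in> borel_measurable M" and \<sigma>: "\<sigma> \<ge> 0"
    and ch: "\<And>t. char (distr M borel X) t = iexp (\<mu> * t) * complex_of_real (exp (- ((\<sigma> * t)^2) / 2))"
  shows "gaussian_rv M X"
proof (cases "\<sigma> = 0")
  case True
  let ?X = "\<lambda>_::'a. \<mu>"
  have "char (distr M borel X) = char (distr M borel ?X)"
  proof
    fix t
    have "char (distr M borel ?X) t = (CLINT x|M. iexp (t * \<mu>))"
      unfolding char_def by (subst integral_distr) auto
    then show "char (distr M borel X) t = char (distr M borel ?X) t"
      using ch[of t] True by (simp add: prob_space mult.commute)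
  qed
  then have "distr M borel X = distr M borel ?X"
    by (intro Levy_uniqueness real_distribution_distr) auto
  then have "measure (distr M borel X) {\<mu>} = measure (distr M borel ?X) {\<mu>}" by simp
  then have "prob (X -` {\<mu>} \<inter> space M) = prob (?X -` {\<mu>} \<inter> space M)"
    by (simp only: measure_distr[OF assms(1)] measure_distr[of ?X M borel] borel_singleton
        measurable_const space_borel UNIV_I sets.empty_sets borel_closed closed_singleton)
  moreover have "?X -` {\<mu>} \<inter> space M = space M" by auto
  ultimately have "prob {\<omega> \<in> space M. X \<omega> = \<mu>} = 1"
    by (simp add: prob_space vimage_def Int_def conj_commute)
  then have "AE \<omega> in M. X \<omega> = \<mu>" by (subst (asm) prob_Collect_eq_1) auto
  then show ?thesis by (auto simp: gaussian_rv_def)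
next
  case False
  then have p: "\<sigma> > 0" using \<sigma> by simp
  let ?N = "density lborel (normal_density \<mu> \<sigma>)"
  interpret N: prob_space ?N by (rule prob_space_normal_density[OF p])
  have rN: "real_distribution ?N" by unfold_locales auto
  have dN: "distributed ?N lborel (\<lambda>x. x) (normal_density \<mu> \<sigma>)"
    unfolding distributed_def by (auto intro!: distr_id2)
  have "distr ?N borel (\<lambda>x. x) = ?N" by (rule distr_id2) simp
  then have "char (distr M borel X) = char ?N"
    using N.char_normal[OF dN p] ch by auto
  then have "distr M borel X = ?N"
    by (intro Levy_uniqueness real_distribution_distr rN) auto
  moreover have "distr M borel X = distr M lborel X" by (rule distr_cong) auto
  ultimately have "distributed M lborel X (normal_density \<mu> \<sigma>)"
    unfolding distributed_def by auto
  then show ?thesis using p by (auto simp: gaussian_rv_def)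
qed

text \<open>The events that all \<open>X k\<close> are bounded by \<open>n\<close> increase to the
  whole space, so one of them has probability above \<open>1 - \<epsilon>\<close>.\<close>

lemma (in prob_space) pointwise_bounded_imp_tight:
  fixes X :: "nat \<Rightarrow> 'a \<Rightarrow> real"
  assumes [measurable]: "\<And>k. X k \<in> borel_measurable M" and B: "\<And>\<omega>. \<omega> \<in> space M \<Longrightarrow> Bseq (\<lambda>k. X k \<omega>)"
    and \<epsilon>: "\<epsilon> > 0"
  obtains B where "B \<ge> 0" "\<And>k. prob {\<omega> \<in> space M. \<bar>X k \<omega>\<bar> \<le> B} > 1 - \<epsilon>"
proof -
  let ?A = "\<lambda>n::nat. {\<omega> \<in> space M. \<forall>k. \<bar>X k \<omega>\<bar> \<le> real n}"
  have "(\<lambda>n. prob (?A n)) \<longlonglongrightarrow> prob (\<Union>n. ?A n)"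
    by (rule finite_Lim_measure_incseq) (auto simp: incseq_def intro: order_trans)
  moreover have "(\<Union>n. ?A n) = space M"
  proof safe
    fix \<omega> assume w: "\<omega> \<in> space M"
    then obtain K where "\<And>k. \<bar>X k \<omega>\<bar> \<le> K" using B unfolding Bseq_def by auto
    moreover obtain n :: nat where "K \<le> real n" using real_arch_simple by blast
    ultimately show "\<omega> \<in> (\<Union>n. ?A n)" using w by (auto intro: order_trans)
  qed
  ultimately have "eventually (\<lambda>n. prob (?A n) > 1 - \<epsilon>) sequentially"
    using \<epsilon> by (intro order_tendstoD) (auto simp: prob_space)
  then obtain n where n: "prob (?A n) > 1 - \<epsilon>"
    by (meson eventually_sequentially order_refl)
  have "prob (?A n) \<le> prob {\<omega> \<in> space M. \<bar>X k \<omega>\<bar> \<le> real n}" for k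
    by (rule finite_measure_mono) auto
  then show thesis using n by (intro that[of "real n"]) (auto intro: less_le_trans)
qed

text \<open>Since a normal variable exceeds its mean with probability \<open>1/2\<close> and has small-ball
  probabilities of order \<open>1/\<sigma>\<close>, tightness bounds the parameters; along a convergent subsequence of
  parameters the characteristic functions converge.\<close>

lemma (in prob_space) gaussian_rv_LIMSEQ:
  fixes X :: "nat \<Rightarrow> 'a \<Rightarrow> real"
  assumes g: "\<And>k. gaussian_rv M (X k)"
    and lim: "\<And>\<omega>. \<omega> \<in> space M \<Longrightarrow> (\<lambda>k. X k \<omega>) \<longlonglongrightarrow> Y \<omega>"
  shows "gaussian_rv M Y"
proof -
  have Xm [measurable]: "X k \<in> borel_measurable M" for k using g by (simp add: gaussian_rv_def)
  have Ym [measurable]: "Y \<in> borel_measurable M" by (rule borel_measurable_LIMSEQ_real[OF lim Xm])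
  define Q where "Q k \<mu> \<sigma> \<longleftrightarrow> \<sigma> \<ge> 0 \<and>
      (\<forall>t. char (distr M borel (X k)) t = iexp (\<mu> * t) * complex_of_real (exp (- ((\<sigma> * t)^2) / 2)))
      \<and> prob {\<omega> \<in> space M. X k \<omega> \<ge> \<mu>} \<ge> 1/2 \<and> prob {\<omega> \<in> space M. X k \<omega> \<le> \<mu>} \<ge> 1/2
      \<and> (\<forall>B\<ge>0. \<sigma> * prob {\<omega> \<in> space M. \<bar>X k \<omega>\<bar> \<le> B} \<le> 2 * B)" for k \<mu> \<sigma>
  have "\<exists>\<mu> \<sigma>. Q k \<mu> \<sigma>" for k
    unfolding Q_def by (rule gaussian_rv_char[OF g[of k]]) blast
  then obtain \<mu> \<sigma> where "\<And>k. Q k (\<mu> k) (\<sigma> k)" by metis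
  then have ms: "\<And>k. \<sigma> k \<ge> 0"
      "\<And>k t. char (distr M borel (X k)) t = iexp (\<mu> k * t) * complex_of_real (exp (- ((\<sigma> k * t)^2) / 2))"
      "\<And>k. prob {\<omega> \<in> space M. X k \<omega> \<ge> \<mu> k} \<ge> 1/2" "\<And>k. prob {\<omega> \<in> space M. X k \<omega> \<le> \<mu> k} \<ge> 1/2"
      "\<And>k B. B \<ge> 0 \<Longrightarrow> \<sigma> k * prob {\<omega> \<in> space M. \<bar>X k \<omega>\<bar> \<le> B} \<le> 2 * B"
    unfolding Q_def by blast+
  have "Bseq (\<lambda>k. X k \<omega>)" if "\<omega> \<in> space M" for \<omega>
    using lim[OF that] by (intro convergent_imp_Bseq convergentI)
  then obtain B where B: "B \<ge> 0" "\<And>k. prob {\<omega> \<in> space M. \<bar>X k \<omega>\<bar> \<le> B} > 1 - 1/2"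
    by (rule pointwise_bounded_imp_tight[OF Xm, where \<epsilon>="1/2"]) auto
  \<comment> \<open>Two events with probabilities at least 1/2 and above 1/2 cannot be disjoint.
    With the two half-lines at \<open>\<mu> k\<close> this traps \<open>\<mu> k\<close> in
    \<open>[-B, B]\<close>.\<close>
  have meet: "\<exists>\<omega>\<in>space M. Q \<omega> \<and> \<bar>X k \<omega>\<bar> \<le> B"
    if Q: "prob {\<omega> \<in> space M. Q \<omega>} \<ge> 1/2" and [measurable]: "Measurable.pred M Q" for Q k
  proof (rule ccontr)
    assume "\<not> ?thesis"
    then have "prob {\<omega> \<in> space M. Q \<omega>} + prob {\<omega> \<in> space M. \<bar>X k \<omega>\<bar> \<le> B} =
        prob ({\<omega> \<in> space M. Q \<omega>} \<union> {\<omega> \<in> space M. \<bar>X k \<omega>\<bar> \<le> B})"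
      by (intro finite_measure_Union[symmetric]) auto
    also have "\<dots> \<le> 1" by (rule prob_le_1)
    finally show False using Q B(2)[of k] by linarith
  qed
  have \<mu>B: "\<bar>\<mu> k\<bar> \<le> B" for k
  proof -
    obtain \<omega> where "X k \<omega> \<ge> \<mu> k" "\<bar>X k \<omega>\<bar> \<le> B"
      using meet[OF ms(3)[of k], of k] by auto
    moreover obtain \<omega>' where "X k \<omega>' \<le> \<mu> k" "\<bar>X k \<omega>'\<bar> \<le> B"
      using meet[OF ms(4)[of k], of k] by auto
    ultimately show ?thesis by linarith
  qed
  \<comment> \<open>The ball of radius \<open>B\<close> has probability above 1/2, so
    \<open>\<sigma> k / 2 \<le> 2 * B\<close>.\<close>
  have \<sigma>B: "\<bar>\<sigma> k\<bar> \<le> 4 * B" for k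
  proof -
    have "\<sigma> k * (1/2) \<le> \<sigma> k * prob {\<omega> \<in> space M. \<bar>X k \<omega>\<bar> \<le> B}"
      using B(2)[of k] ms(1)[of k] by (intro mult_left_mono) auto
    then show ?thesis using ms(5)[OF B(1), of k] ms(1)[of k] by linarith
  qed
  have "bounded (range (\<lambda>k. (\<mu> k, \<sigma> k)))"
  proof (rule bounded_subset)
    show "bounded ({-B..B} \<times> {-4*B..4*B})" by (intro bounded_Times bounded_closed_interval)
    show "range (\<lambda>k. (\<mu> k, \<sigma> k)) \<subseteq> {-B..B} \<times> {-4*B..4*B}"
      using \<mu>B[THEN abs_le_D1] \<mu>B[THEN abs_le_D2] \<sigma>B[THEN abs_le_D1] \<sigma>B[THEN abs_le_D2]
      by (auto simp: minus_le_iff)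
  qed
  then obtain l r where r: "strict_mono (r::nat\<Rightarrow>nat)" "((\<lambda>k. (\<mu> k, \<sigma> k)) \<circ> r) \<longlonglongrightarrow> l"
    using bounded_imp_convergent_subsequence by blast
  have m: "(\<lambda>k. \<mu> (r k)) \<longlonglongrightarrow> fst l" and s: "(\<lambda>k. \<sigma> (r k)) \<longlonglongrightarrow> snd l"
    using tendsto_fst[OF r(2)] tendsto_snd[OF r(2)] by (simp_all add: o_def)
  have s0: "snd l \<ge> 0" by (rule LIMSEQ_le_const[OF s]) (use ms in auto)
  have "char (distr M borel Y) t = iexp (fst l * t) * complex_of_real (exp (- ((snd l * t)^2) / 2))" for t
  \<comment> \<open>One limit comes from the parameters, the other from dominated convergence of
    \<open>X (r k)\<close> to \<open>Y\<close>.\<close>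
  proof (rule LIMSEQ_unique)
    show "(\<lambda>k. char (distr M borel (X (r k))) t) \<longlonglongrightarrow>
        iexp (fst l * t) * complex_of_real (exp (- ((snd l * t)^2) / 2))"
      unfolding ms(2) by (intro tendsto_intros m s) auto
    have "(\<lambda>k. CLINT x|M. iexp (t * X (r k) x)) \<longlonglongrightarrow> (CLINT x|M. iexp (t * Y x))"
    proof (rule integral_dominated_convergence[where w="\<lambda>_. 1"])
      show "AE x in M. (\<lambda>k. iexp (t * X (r k) x)) \<longlonglongrightarrow> iexp (t * Y x)"
        using LIMSEQ_subseq_LIMSEQ[OF lim r(1)]
        by (intro AE_I2 tendsto_intros) (auto simp: o_def)
    qed auto
    then show "(\<lambda>k. char (distr M borel (X (r k))) t) \<longlonglongrightarrow> char (distr M borel Y) t"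
      unfolding char_def by (subst (1 2) integral_distr) auto
  qed
  then show ?thesis by (rule gaussian_rv_if_char[OF Ym s0])
qed

subsection \<open>The integral as a Lipschitz operator on bounded functions\<close>

text \<open>Finiteness makes \<open>real_of_ereal\<close> faithful here.\<close>

lemma limsup_real_bounds:
  fixes a :: "nat \<Rightarrow> real"
  assumes "\<And>k. \<bar>a k\<bar> \<le> B"
  shows "\<bar>limsup (\<lambda>k. ereal (a k))\<bar> \<noteq> \<infinity>" "\<bar>real_of_ereal (limsup (\<lambda>k. ereal (a k)))\<bar> \<le> B"
proof -
  have "limsup (\<lambda>k. ereal (a k)) \<le> ereal B"
    using assms by (intro Limsup_bounded always_eventually) (auto simp: abs_le_iff)
  moreover have "ereal (- B) \<le> limsup (\<lambda>k. ereal (a k))"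
    using assms by (intro le_Limsup always_eventually) (auto simp: abs_le_iff minus_le_iff)
  ultimately show "\<bar>limsup (\<lambda>k. ereal (a k))\<bar> \<noteq> \<infinity>" "\<bar>real_of_ereal (limsup (\<lambda>k. ereal (a k)))\<bar> \<le> B"
    by (cases "limsup (\<lambda>k. ereal (a k))"; auto)+
qed

text \<open>Stands in for linearity, which upper limits lack: \<open>u \<le> v + c\<close> passes to
  upper limits, and this is used in both directions.\<close>

lemma limsup_real_diff_le:
  fixes a b :: "nat \<Rightarrow> real"
  assumes a: "\<And>k. \<bar>a k\<bar> \<le> A" and b: "\<And>k. \<bar>b k\<bar> \<le> B" and c: "\<And>k. \<bar>a k - b k\<bar> \<le> c"
  shows "\<bar>real_of_ereal (limsup (\<lambda>k. ereal (a k))) - real_of_ereal (limsup (\<lambda>k. ereal (b k)))\<bar> \<le> c"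
proof -
  have le: "limsup (\<lambda>k. ereal (u k)) \<le> limsup (\<lambda>k. ereal (v k)) + ereal c"
    if "\<And>k. \<bar>u k - v k\<bar> \<le> c" for u v :: "nat \<Rightarrow> real"
  proof -
    have "limsup (\<lambda>k. ereal (u k)) \<le> limsup (\<lambda>k. ereal (v k) + ereal c)"
    proof (intro Limsup_mono always_eventually allI)
      fix k show "ereal (u k) \<le> ereal (v k) + ereal c" using that[of k] by simp
    qed
    then show ?thesis by (subst (asm) Limsup_add_ereal_right) auto
  qed
  have "limsup (\<lambda>k. ereal (a k)) \<le> limsup (\<lambda>k. ereal (b k)) + ereal c"
    "limsup (\<lambda>k. ereal (b k)) \<le> limsup (\<lambda>k. ereal (a k)) + ereal c"
    using c by (intro le; simp add: abs_minus_commute)+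
  then show ?thesis
    using limsup_real_bounds(1)[of a, OF a] limsup_real_bounds(1)[of b, OF b]
    by (cases "limsup (\<lambda>k. ereal (a k))"; cases "limsup (\<lambda>k. ereal (b k))") auto
qed

text \<open>The upper limit makes the operator total, so that no extension argument is needed for functions
  against which the sums do not converge.\<close>

definition rs_op :: "(real \<Rightarrow> real) set \<Rightarrow> (real \<Rightarrow> real) \<Rightarrow> (real \<Rightarrow> real) \<Rightarrow> real" where
  "rs_op \<G> z = (\<lambda>g\<in>\<G>. real_of_ereal (limsup (\<lambda>k. ereal (rs_sum k z g))))"

lemma rs_op_eqI:
  assumes "g \<in> \<G>" "(\<lambda>k. rs_sum k z g) \<longlonglongrightarrow> l"
  shows "rs_op \<G> z g = l"
proof -
  have "(\<lambda>k. ereal (rs_sum k z g)) \<longlonglongrightarrow> ereal l" using assms by simp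
  from lim_imp_Limsup[OF _ this] show ?thesis using assms(1) by (simp add: rs_op_def)
qed

lemma BV_rc_rc_bounded: "g \<in> BV_rc T \<Longrightarrow> rc_bounded T g"
  by (auto simp: BV_rc_def BV_def rc_bounded_def)

lemma BV_rc_BV: "g \<in> BV_rc T \<Longrightarrow> g \<in> BV T"
  by (auto simp: BV_rc_def)

context
  fixes T :: real and \<G> :: "(real \<Rightarrow> real) set"
  assumes T: "T \<ge> 0" and \<G>: "\<G> \<subseteq> BV_rc T"
begin

lemma rs_op_mspace:
  assumes z: "z \<in> mspace (linf UNIV)"
  shows "rs_op \<G> z \<in> mspace (linf \<G>)"
proof -
  obtain b where b: "\<And>t. \<bar>z t\<bar> \<le> b" using z by (auto simp: mspace_linf)
  have "\<bar>rs_op \<G> z g\<bar> \<le> 3 * T * b" if g: "g \<in> \<G>" for g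
    using limsup_real_bounds(2)[of "\<lambda>k. rs_sum k z g", OF rs_sum_le[OF BV_rc_BV T b]] g \<G>
    by (auto simp: rs_op_def)
  then show ?thesis by (auto simp: mspace_linf rs_op_def)
qed

text \<open>Each sum is linear in \<open>z\<close>, so \<open>rs_sum_le\<close> applied to
  \<open>z - w\<close> bounds the difference uniformly in \<open>k\<close>, and the bound survives
  the upper limit.\<close>

lemma rs_op_Lipschitz:
  assumes z: "z \<in> mspace (linf UNIV)" and w: "w \<in> mspace (linf UNIV)"
  shows "mdist (linf \<G>) (rs_op \<G> z) (rs_op \<G> w) \<le> 3 * T * mdist (linf UNIV) z w"
proof (rule mdist_linf_least)
  show "0 \<le> 3 * T * mdist (linf UNIV) z w" using T by simp
  fix g assume g: "g \<in> \<G>"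
  then have gb: "g \<in> BV T" using \<G> by (auto intro: BV_rc_BV)
  obtain b where b: "\<And>t. \<bar>z t\<bar> \<le> b" using z by (auto simp: mspace_linf)
  obtain c where c: "\<And>t. \<bar>w t\<bar> \<le> c" using w by (auto simp: mspace_linf)
  have "\<bar>rs_sum k z g - rs_sum k w g\<bar> \<le> 3 * T * mdist (linf UNIV) z w" for k
    unfolding rs_sum_diff_left[symmetric]
    by (rule rs_sum_le[OF gb T]) (rule mdist_linf_upper[OF z w UNIV_I])
  from limsup_real_diff_le[OF rs_sum_le[OF gb T b] rs_sum_le[OF gb T c] this]
  show "\<bar>rs_op \<G> z g - rs_op \<G> w g\<bar> \<le> 3 * T * mdist (linf UNIV) z w"
    using g by (simp add: rs_op_def)
qed

lemma continuous_map_rs_op: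
  "continuous_map (mtopology_of (linf UNIV)) (mtopology_of (linf \<G>)) (rs_op \<G>)"
proof -
  have "Lipschitz_continuous_map (linf UNIV) (linf \<G>) (rs_op \<G>)"
    unfolding Lipschitz_continuous_map_def using rs_op_mspace rs_op_Lipschitz by blast
  then show ?thesis
    by (intro uniformly_continuous_imp_continuous_map Lipschitz_imp_uniformly_continuous_map)
qed

end

section \<open>Gaussian laws of the sums\<close>

text \<open>The points \<open>x i\<close> may coincide whereas \<open>gaussian_process\<close> sums
  over a set of points, so the coefficients are collected point by point.\<close>

lemma gaussian_rv_finite_combination:
  assumes Y: "gaussian_process N UNIV Y" and J: "finite J"
  shows "gaussian_rv N (\<lambda>\<omega>. \<Sum>i\<in>J. c i * Y \<omega> (x i))"
proof -
  have "(\<Sum>i\<in>J. c i * Y \<omega> (x i)) = (\<Sum>s\<in>x ` J. (\<Sum>i\<in>{i\<in>J. x i = s}. c i) * Y \<omega> s)" for \<omega>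
    by (subst sum.image_gen[OF J, of _ x]) (auto simp: sum_distrib_right intro!: sum.cong)
  then show ?thesis using Y J unfolding gaussian_process_def by simp
qed

lemma gaussian_rv_rs_sum:
  assumes Y: "gaussian_process N UNIV Y" and I: "finite I"
  shows "gaussian_rv N (\<lambda>\<omega>. \<Sum>g\<in>I. a g * rs_sum k (Y \<omega>) g)"
proof -
  \<comment> \<open>The left summand of \<open>?P <+> ?P\<close> indexes the right end points of
    cells, the right summand the left end points with negated coefficients.\<close>
  let ?P = "I \<times> {..<grid_size k}"
  let ?c = "\<lambda>(g, j). a g * g (grid k (Suc j))"
  let ?d = "case_sum ?c (\<lambda>p. - ?c p)"
  let ?x = "case_sum (\<lambda>(g, j). grid k (Suc j)) (\<lambda>(g, j). grid k j)"
  have "(\<Sum>g\<in>I. a g * rs_sum k (Y \<omega>) g) = (\<Sum>i\<in>?P <+> ?P. ?d i * Y \<omega> (?x i))" for \<omega>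
  proof -
    have "(\<Sum>g\<in>I. a g * rs_sum k (Y \<omega>) g) =
        (\<Sum>(g, j)\<in>?P. a g * (g (grid k (Suc j)) * (Y \<omega> (grid k (Suc j)) - Y \<omega> (grid k j))))"
      by (simp add: rs_sum_def sum_distrib_left sum.cartesian_product)
    also have "\<dots> = (\<Sum>i\<in>?P <+> ?P. ?d i * Y \<omega> (?x i))"
      using I by (simp add: sum.Plus sum.distrib[symmetric] case_prod_beta algebra_simps)
    finally show ?thesis .
  qed
  then show ?thesis
    using gaussian_rv_finite_combination[OF Y, of "?P <+> ?P" ?d ?x] I by simp
qed

subsection \<open>Paths that are uniformly continuous with respect to a distribution function\<close>

text \<open>The inf-convolution with a steep cone.\<close>

lemma Lipschitz_regularization:
  fixes F z :: "real \<Rightarrow> real"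
  assumes z: "\<And>t. \<bar>z t\<bar> \<le> b" and uc: "semimetric_uniformly_continuous UNIV (\<lambda>s t. \<bar>F s - F t\<bar>) z"
    and \<epsilon>: "\<epsilon> > 0"
  obtains \<psi> K where "K \<ge> 0" "\<And>u v. \<bar>\<psi> u - \<psi> v\<bar> \<le> K * \<bar>u - v\<bar>" "\<And>t. \<bar>z t - \<psi> (F t)\<bar> \<le> \<epsilon>"
proof -
  have b0: "0 \<le> b" using z[of 0] by linarith
  have "\<exists>\<delta>>0. \<forall>s\<in>UNIV. \<forall>t\<in>UNIV. \<bar>F s - F t\<bar> < \<delta> \<longrightarrow> \<bar>z s - z t\<bar> < \<epsilon>"
    using uc \<epsilon> by (simp only: semimetric_uniformly_continuous_def)
  then obtain \<delta> where \<delta>: "\<delta> > 0" "\<And>s t. \<bar>F s - F t\<bar> < \<delta> \<Longrightarrow> \<bar>z s - z t\<bar> < \<epsilon>"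
    by (elim exE conjE) simp
  \<comment> \<open>At distance \<open>\<delta>\<close> in \<open>F\<close> the cone has height
    \<open>2 * b\<close>, the largest possible oscillation of \<open>z\<close>.\<close>
  define K where "K = 2 * b / \<delta>"
  have K: "K \<ge> 0" using b0 \<delta> by (simp add: K_def)
  define \<psi> where "\<psi> u = (INF s. z s + K * \<bar>u - F s\<bar>)" for u
  have bdd: "bdd_below (range (\<lambda>s. z s + K * \<bar>u - F s\<bar>))" for u
  proof (rule bdd_belowI2)
    fix s show "- b \<le> z s + K * \<bar>u - F s\<bar>"
      using z[of s] mult_nonneg_nonneg[OF K abs_ge_zero[of "u - F s"]] by linarith
  qed
  have le: "\<psi> u - K * \<bar>u - v\<bar> \<le> \<psi> v" for u v
    unfolding \<psi>_def[of v]
  proof (rule cINF_greatest)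
    fix s
    have "\<psi> u \<le> z s + K * \<bar>u - F s\<bar>" unfolding \<psi>_def by (rule cINF_lower[OF bdd]) auto
    also have "\<dots> \<le> z s + K * (\<bar>v - F s\<bar> + \<bar>u - v\<bar>)"
      using K by (intro add_left_mono mult_left_mono) auto
    finally show "\<psi> u - K * \<bar>u - v\<bar> \<le> z s + K * \<bar>v - F s\<bar>" by (simp add: algebra_simps)
  qed auto
  have "\<bar>\<psi> u - \<psi> v\<bar> \<le> K * \<bar>u - v\<bar>" for u v
    using le[of u v] le[of v u] by (simp add: abs_minus_commute)
  moreover have "\<bar>z t - \<psi> (F t)\<bar> \<le> \<epsilon>" for t
  proof -
    have "\<psi> (F t) \<le> z t + K * \<bar>F t - F t\<bar>" unfolding \<psi>_def by (rule cINF_lower[OF bdd]) auto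
    \<comment> \<open>Points \<open>s\<close> close to \<open>t\<close> in \<open>F\<close> are
      handled by uniform continuity, all others by the height of the cone.\<close>
    moreover have "z t - \<epsilon> \<le> \<psi> (F t)"
      unfolding \<psi>_def
    proof (rule cINF_greatest)
      fix s
      show "z t - \<epsilon> \<le> z s + K * \<bar>F t - F s\<bar>"
      proof (cases "\<bar>F s - F t\<bar> < \<delta>")
        case True
        then show ?thesis
          using \<delta>(2)[of s t] mult_nonneg_nonneg[OF K abs_ge_zero[of "F t - F s"]] by linarith
      next
        case False
        then have "K * \<delta> \<le> K * \<bar>F t - F s\<bar>" using K by (intro mult_left_mono) auto
        moreover have "K * \<delta> = 2 * b" using \<delta> by (simp add: K_def)
        ultimately show ?thesis using z[of s] z[of t] \<epsilon> by linarith
      qed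
    qed auto
    ultimately show ?thesis by simp
  qed
  ultimately show thesis using that K by blast
qed

context
  fixes F :: "real \<Rightarrow> real"
  assumes mono: "\<And>s t. s \<le> t \<Longrightarrow> F s \<le> F t" and rc: "\<And>t. continuous (at_right t) F"
    and F1: "\<And>t. \<bar>F t\<bar> \<le> 1"
begin

text \<open>Adding \<open>K * F\<close> to \<open>\<psi> \<circ> F\<close> makes it nondecreasing,
  so \<open>\<psi> \<circ> F\<close> is a difference of two functions that induce finite
  measures.\<close>

lemma convergent_rs_sum_Lipschitz:
  assumes K: "K \<ge> 0" and \<psi>: "\<And>u v. \<bar>\<psi> u - \<psi> v\<bar> \<le> K * \<bar>u - v\<bar>" and g: "rc_bounded B g"
  shows "convergent (\<lambda>k. rs_sum k (\<lambda>t. \<psi> (F t)) g)"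
proof -
  define H where "H t = \<psi> (F t) + K * F t" for t
  have "K-lipschitz_on UNIV \<psi>"
    using K \<psi> by (intro lipschitz_onI) (auto simp: dist_real_def)
  then have c\<psi>: "isCont \<psi> u" for u
    using lipschitz_on_continuous_on continuous_on_eq_continuous_at by blast
  have "H s \<le> H t" if "s \<le> t" for s t
    using \<psi>[of "F s" "F t"] mono[OF that] by (simp add: H_def algebra_simps)
  moreover have "continuous (at_right t) H" for t
  proof -
    have F: "(F \<longlongrightarrow> F t) (at_right t)" using rc[of t] by (simp add: continuous_within)
    show ?thesis
      unfolding H_def continuous_within by (intro tendsto_intros isCont_tendsto_compose[OF c\<psi>] F)
  qed
  moreover have "\<bar>H t\<bar> \<le> \<bar>\<psi> 0\<bar> + 2 * K" for t
  proof -
    have "K * \<bar>F t\<bar> \<le> K" using F1[of t] K mult_left_mono[of "\<bar>F t\<bar>" 1 K] by simp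
    moreover have "\<bar>K * F t\<bar> = K * \<bar>F t\<bar>" using K by (simp add: abs_mult)
    ultimately show ?thesis using \<psi>[of "F t" 0] by (simp add: H_def)
  qed
  ultimately have "(\<lambda>k. rs_sum k H g) \<longlonglongrightarrow> ls_integral H g"
    by (rule rs_sum_LIMSEQ_interval_measure[OF _ _ _ g])
  then have "(\<lambda>k. rs_sum k H g - K * rs_sum k F g) \<longlonglongrightarrow> ls_integral H g - K * ls_integral F g"
    by (intro tendsto_intros rs_sum_LIMSEQ_interval_measure[OF mono rc F1 g])
  moreover have "rs_sum k (\<lambda>t. \<psi> (F t)) g = rs_sum k H g - K * rs_sum k F g" for k
    unfolding rs_sum_cmult_left[symmetric] rs_sum_diff_left[symmetric] by (simp add: H_def)
  ultimately show ?thesis by (auto simp: convergent_def)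
qed

text \<open>The increments of \<open>\<psi> \<circ> F\<close> are at most \<open>K\<close> times
  those of \<open>F\<close>, which are nonnegative. The right-hand side tends to \<open>K\<close>
  times the \<open>L_1(F)\<close> distance.\<close>

lemma rs_sum_Lipschitz_L1:
  assumes \<psi>: "\<And>u v. \<bar>\<psi> u - \<psi> v\<bar> \<le> K * \<bar>u - v\<bar>"
  shows "\<bar>rs_sum k (\<lambda>t. \<psi> (F t)) f - rs_sum k (\<lambda>t. \<psi> (F t)) g\<bar> \<le> K * rs_sum k F (\<lambda>x. \<bar>f x - g x\<bar>)"
  unfolding rs_sum_diff_right[symmetric] unfolding rs_sum_def sum_distrib_left
proof (rule order_trans[OF sum_abs sum_mono])
  fix j
  let ?x = "grid k (Suc j)" and ?y = "grid k j"
  have "\<bar>(f ?x - g ?x) * (\<psi> (F ?x) - \<psi> (F ?y))\<bar> \<le> \<bar>f ?x - g ?x\<bar> * (K * \<bar>F ?x - F ?y\<bar>)"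
    unfolding abs_mult by (intro mult_left_mono \<psi>) auto
  then show "\<bar>(f ?x - g ?x) * (\<psi> (F ?x) - \<psi> (F ?y))\<bar> \<le> K * (\<bar>f ?x - g ?x\<bar> * (F ?x - F ?y))"
    using mono[OF grid_le[of k j]] by (simp add: mult_ac)
qed

context
  fixes z :: "real \<Rightarrow> real" and b T :: real
  assumes z: "\<And>t. \<bar>z t\<bar> \<le> b" and uc: "semimetric_uniformly_continuous UNIV (\<lambda>s t. \<bar>F s - F t\<bar>) z"
    and T: "T > 0"
begin

lemma rs_sum_uc_approx:
  assumes \<epsilon>: "\<epsilon> > 0"
  obtains \<psi> K where "K \<ge> 0" "\<And>u v. \<bar>\<psi> u - \<psi> v\<bar> \<le> K * \<bar>u - v\<bar>"
    "\<And>g k. g \<in> BV T \<Longrightarrow> \<bar>rs_sum k z g - rs_sum k (\<lambda>t. \<psi> (F t)) g\<bar> \<le> \<epsilon>"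
proof -
  \<comment> \<open>The accuracy \<open>\<epsilon> / (3 * T)\<close> offsets the factor in
    \<open>rs_sum_le\<close>, which makes the approximation uniform in \<open>g\<close> and
    \<open>k\<close>.\<close>
  obtain \<psi> K where *: "K \<ge> 0" "\<And>u v. \<bar>\<psi> u - \<psi> v\<bar> \<le> K * \<bar>u - v\<bar>" "\<And>t. \<bar>z t - \<psi> (F t)\<bar> \<le> \<epsilon> / (3 * T)"
    by (rule Lipschitz_regularization[OF z uc, of "\<epsilon> / (3 * T)"]) (use \<epsilon> T in auto)
  have "\<bar>rs_sum k z g - rs_sum k (\<lambda>t. \<psi> (F t)) g\<bar> \<le> 3 * T * (\<epsilon> / (3 * T))" if "g \<in> BV T" for g k
    unfolding rs_sum_diff_left[symmetric] by (rule rs_sum_le[OF that]) (use T * in auto)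
  then show thesis using * T by (intro that[of K \<psi>]) auto
qed

text \<open>A limit, uniform in \<open>k\<close>, of convergent sequences is Cauchy. On such paths
  the upper limit in \<open>rs_op\<close> is therefore a limit.\<close>

lemma convergent_rs_sum_uc:
  assumes g: "g \<in> BV_rc T"
  shows "convergent (\<lambda>k. rs_sum k z g)"
proof (rule Cauchy_convergent, rule metric_CauchyI)
  fix \<epsilon> :: real assume \<epsilon>: "\<epsilon> > 0"
  then have "\<epsilon> / 3 > 0" by simp
  then obtain \<psi> K where *: "K \<ge> 0" "\<And>u v. \<bar>\<psi> u - \<psi> v\<bar> \<le> K * \<bar>u - v\<bar>"
    "\<And>g k. g \<in> BV T \<Longrightarrow> \<bar>rs_sum k z g - rs_sum k (\<lambda>t. \<psi> (F t)) g\<bar> \<le> \<epsilon> / 3"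
    by (rule rs_sum_uc_approx) (rule that)
  have "Cauchy (\<lambda>k. rs_sum k (\<lambda>t. \<psi> (F t)) g)"
    using convergent_rs_sum_Lipschitz[OF *(1,2) BV_rc_rc_bounded[OF g]] by (rule convergent_Cauchy)
  then obtain n where n: "\<And>i j. i \<ge> n \<Longrightarrow> j \<ge> n \<Longrightarrow>
      \<bar>rs_sum i (\<lambda>t. \<psi> (F t)) g - rs_sum j (\<lambda>t. \<psi> (F t)) g\<bar> < \<epsilon> / 3"
    using \<epsilon> metric_CauchyD[of "\<lambda>k. rs_sum k (\<lambda>t. \<psi> (F t)) g" "\<epsilon> / 3"]
    unfolding dist_real_def by (metis zero_less_divide_iff zero_less_numeral)
  show "\<exists>M. \<forall>i\<ge>M. \<forall>j\<ge>M. dist (rs_sum i z g) (rs_sum j z g) < \<epsilon>"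
  proof (intro exI allI impI)
    fix i j assume "n \<le> i" "n \<le> j"
    from n[OF this] show "dist (rs_sum i z g) (rs_sum j z g) < \<epsilon>"
      using *(3)[OF BV_rc_BV[OF g], of i] *(3)[OF BV_rc_BV[OF g], of j]
      unfolding dist_real_def by linarith
  qed
qed

lemma rs_op_uc_LIMSEQ:
  assumes "g \<in> \<G>" "\<G> \<subseteq> BV_rc T"
  shows "(\<lambda>k. rs_sum k z g) \<longlonglongrightarrow> rs_op \<G> z g"
proof -
  obtain l where "(\<lambda>k. rs_sum k z g) \<longlonglongrightarrow> l"
    using convergent_rs_sum_uc assms by (auto simp: convergent_def)
  then show ?thesis using rs_op_eqI[OF assms(1)] by simp
qed

lemma rs_op_uniformly_continuous:
  assumes \<G>: "\<G> \<subseteq> BV_rc T"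
  shows "semimetric_uniformly_continuous \<G> (\<lambda>f g. ls_integral F (\<lambda>x. \<bar>f x - g x\<bar>)) (rs_op \<G> z)"
  unfolding semimetric_uniformly_continuous_def
proof (intro allI impI)
  fix \<epsilon> :: real assume \<epsilon>: "\<epsilon> > 0"
  then have "\<epsilon> / 4 > 0" by simp
  then obtain \<psi> K where *: "K \<ge> 0" "\<And>u v. \<bar>\<psi> u - \<psi> v\<bar> \<le> K * \<bar>u - v\<bar>"
    "\<And>g k. g \<in> BV T \<Longrightarrow> \<bar>rs_sum k z g - rs_sum k (\<lambda>t. \<psi> (F t)) g\<bar> \<le> \<epsilon> / 4"
    by (rule rs_sum_uc_approx) (rule that)
  \<comment> \<open>Replacing \<open>z\<close> by \<open>\<psi> \<circ> F\<close> for both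
    \<open>f\<close> and \<open>g\<close> costs \<open>\<epsilon> / 2\<close>; this
    \<open>\<delta>\<close> keeps the rest strictly below \<open>\<epsilon> / 2\<close>, also for
    \<open>K = 0\<close>.\<close>
  define \<delta> where "\<delta> = \<epsilon> / (2 * (K + 1))"
  have \<delta>: "\<delta> > 0" using \<epsilon> * by (simp add: \<delta>_def)
  have K\<delta>: "K * \<delta> < \<epsilon> / 2"
  proof -
    have "K * \<epsilon> < (K + 1) * \<epsilon>" using \<epsilon> by simp
    then show ?thesis using * by (simp add: \<delta>_def field_simps)
  qed
  show "\<exists>\<delta>>0. \<forall>f\<in>\<G>. \<forall>g\<in>\<G>. ls_integral F (\<lambda>x. \<bar>f x - g x\<bar>) < \<delta> \<longrightarrow> \<bar>rs_op \<G> z f - rs_op \<G> z g\<bar> < \<epsilon>"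
  proof (intro exI[of _ \<delta>] conjI ballI impI \<delta>)
    fix f g assume fg: "f \<in> \<G>" "g \<in> \<G>" "ls_integral F (\<lambda>x. \<bar>f x - g x\<bar>) < \<delta>"
    then have fg': "f \<in> BV_rc T" "g \<in> BV_rc T" using \<G> by auto
    have "\<bar>rs_op \<G> z f - rs_op \<G> z g\<bar> \<le> \<epsilon> / 2 + K * ls_integral F (\<lambda>x. \<bar>f x - g x\<bar>)"
    proof (rule LIMSEQ_le)
      show "(\<lambda>k. \<bar>rs_sum k z f - rs_sum k z g\<bar>) \<longlonglongrightarrow> \<bar>rs_op \<G> z f - rs_op \<G> z g\<bar>"
        by (intro tendsto_intros rs_op_uc_LIMSEQ \<G> fg)
      show "(\<lambda>k. \<epsilon> / 2 + K * rs_sum k F (\<lambda>x. \<bar>f x - g x\<bar>)) \<longlonglongrightarrow>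
          \<epsilon> / 2 + K * ls_integral F (\<lambda>x. \<bar>f x - g x\<bar>)"
        by (intro tendsto_intros rs_sum_LIMSEQ_interval_measure[OF mono rc F1
            rc_bounded_abs_diff[OF BV_rc_rc_bounded[OF fg'(1)] BV_rc_rc_bounded[OF fg'(2)]]])
      have "\<bar>rs_sum k z f - rs_sum k z g\<bar> \<le> \<epsilon> / 2 + K * rs_sum k F (\<lambda>x. \<bar>f x - g x\<bar>)" for k
        using *(3)[OF BV_rc_BV[OF fg'(1)], of k] *(3)[OF BV_rc_BV[OF fg'(2)], of k]
          rs_sum_Lipschitz_L1[OF *(2), of k f g] by linarith
      then show "\<exists>n. \<forall>k\<ge>n. \<bar>rs_sum k z f - rs_sum k z g\<bar> \<le> \<epsilon> / 2 + K * rs_sum k F (\<lambda>x. \<bar>f x - g x\<bar>)"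
        by blast
    qed
    moreover have "K * ls_integral F (\<lambda>x. \<bar>f x - g x\<bar>) \<le> K * \<delta>"
      using fg * by (intro mult_left_mono) auto
    ultimately show "\<bar>rs_op \<G> z f - rs_op \<G> z g\<bar> < \<epsilon>" using K\<delta> by linarith
  qed
qed

end

text \<open>Measurability comes from continuity of the operator; Gaussianity and path continuity use
  that on the paths of \<open>Y\<close> the sums converge.\<close>

lemma uc_gaussian_process_rs_op:
  assumes Y: "uc_gaussian_process UNIV (\<lambda>s t. \<bar>F s - F t\<bar>) N Y" and T: "T > 0" and \<G>: "\<G> \<subseteq> BV_rc T"
  shows "uc_gaussian_process \<G> (\<lambda>f g. ls_integral F (\<lambda>x. \<bar>f x - g x\<bar>)) N (\<lambda>\<omega>. rs_op \<G> (Y \<omega>))"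
proof -
  interpret N: prob_space N using Y by (simp add: uc_gaussian_process_def)
  have Ym: "Y \<in> N \<rightarrow>\<^sub>M linf_borel UNIV" and Yg: "gaussian_process N UNIV Y"
    and Yuc: "\<And>\<omega>. \<omega> \<in> space N \<Longrightarrow> semimetric_uniformly_continuous UNIV (\<lambda>s t. \<bar>F s - F t\<bar>) (Y \<omega>)"
    using Y by (auto simp: uc_gaussian_process_def)
  have Yb: "\<exists>b. \<forall>t. \<bar>Y \<omega> t\<bar> \<le> b" if "\<omega> \<in> space N" for \<omega>
    using measurable_space[OF Ym that] by (auto simp: mspace_linf)
  have T0: "T \<ge> 0" using T by simp
  have "(\<lambda>\<omega>. rs_op \<G> (Y \<omega>)) \<in> N \<rightarrow>\<^sub>M linf_borel \<G>"
    using measurable_compose[OF Ym continuous_map_linf_borel_measurable[OF continuous_map_rs_op[OF T0 \<G>]]] .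
  moreover have "gaussian_process N \<G> (\<lambda>\<omega>. rs_op \<G> (Y \<omega>))"
    unfolding gaussian_process_def
  proof (intro allI impI)
    fix I :: "(real \<Rightarrow> real) set" and a assume I: "finite I \<and> I \<subseteq> \<G>"
    show "gaussian_rv N (\<lambda>\<omega>. \<Sum>g\<in>I. a g * rs_op \<G> (Y \<omega>) g)"
    proof (rule N.gaussian_rv_LIMSEQ)
      show "gaussian_rv N (\<lambda>\<omega>. \<Sum>g\<in>I. a g * rs_sum k (Y \<omega>) g)" for k
        using I by (intro gaussian_rv_rs_sum Yg) auto
      fix \<omega> assume w: "\<omega> \<in> space N"
      obtain b where b: "\<And>t. \<bar>Y \<omega> t\<bar> \<le> b" using Yb[OF w] by blast
      show "(\<lambda>k. \<Sum>g\<in>I. a g * rs_sum k (Y \<omega>) g) \<longlonglongrightarrow> (\<Sum>g\<in>I. a g * rs_op \<G> (Y \<omega>) g)"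
        using I by (intro tendsto_intros rs_op_uc_LIMSEQ[OF b Yuc[OF w] T _ \<G>]) auto
    qed
  qed
  moreover have "semimetric_uniformly_continuous \<G> (\<lambda>f g. ls_integral F (\<lambda>x. \<bar>f x - g x\<bar>)) (rs_op \<G> (Y \<omega>))"
    if w: "\<omega> \<in> space N" for \<omega>
  proof -
    obtain b where b: "\<And>t. \<bar>Y \<omega> t\<bar> \<le> b" using Yb[OF w] by blast
    show ?thesis by (rule rs_op_uniformly_continuous[OF b Yuc[OF w] T \<G>])
  qed
  ultimately show ?thesis using N.prob_space_axioms by (simp add: uc_gaussian_process_def)
qed

end

subsection \<open>Empirical and bootstrap processes\<close>

text \<open>For \<open>n = 0\<close> division by zero gives the value 0.\<close>

lemma ecdf_abs_le: "\<bar>ecdf n x t\<bar> \<le> 1"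
proof -
  have "(\<Sum>i=1..n. indicat_real {..t} (x i)) \<le> (\<Sum>i=1..n. 1)"
    by (intro sum_mono) (auto simp: indicator_def)
  moreover have "0 \<le> (\<Sum>i=1..n. indicat_real {..t} (x i))"
    by (intro sum_nonneg) (auto simp: indicator_def)
  ultimately have "0 \<le> ecdf n x t" "ecdf n x t \<le> 1"
    by (auto simp: ecdf_def divide_le_eq)
  then show ?thesis by simp
qed

lemma scaled_diff_mspace_linf:
  assumes "\<And>t. \<bar>f t\<bar> \<le> 1" "\<And>t. \<bar>g t\<bar> \<le> (1::real)"
  shows "(\<lambda>t. c * (f t - g t)) \<in> mspace (linf UNIV)"
proof -
  have "\<bar>c * (f t - g t)\<bar> \<le> \<bar>c\<bar> * 2" for t
  proof -
    have "\<bar>f t - g t\<bar> \<le> 2" using assms(1)[of t] assms(2)[of t] by linarith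
    then show ?thesis unfolding abs_mult by (intro mult_left_mono) auto
  qed
  then show ?thesis by (auto simp: mspace_linf)
qed

lemma boot_process_mspace: "boot_process n m x y \<in> mspace (linf UNIV)"
  using scaled_diff_mspace_linf[of "ecdf m y" "ecdf n x" "sqrt m"]
  by (simp add: boot_process_eq[abs_def] ecdf_abs_le)

text \<open>The sums converge for both empirical distribution functions; outside \<open>\<G>\<close>
  both sides are \<open>undefined\<close>.\<close>

lemma rs_op_boot_process:
  assumes \<G>: "\<G> \<subseteq> BV_rc T" and nm: "n > 0" "m > 0"
  shows "rs_op \<G> (boot_process n m x y) = boot_integral \<G> n m x y"
proof (rule ext)
  fix g show "rs_op \<G> (boot_process n m x y) g = boot_integral \<G> n m x y g"
  proof (cases "g \<in> \<G>")
    case True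
    then have g: "rc_bounded T g" using \<G> BV_rc_rc_bounded by auto
    have "(\<lambda>k. rs_sum k (boot_process n m x y) g) \<longlonglongrightarrow>
        sqrt m * (ls_integral (ecdf m y) g - ls_integral (ecdf n x) g)"
      unfolding boot_process_eq[abs_def] rs_sum_cmult_left rs_sum_diff_left
      by (intro tendsto_intros rs_sum_LIMSEQ_ecdf[OF _ g] nm)
    from rs_op_eqI[OF True this] show ?thesis using True by (simp add: boot_integral_def)
  qed (simp add: rs_op_def boot_integral_def)
qed

lemma rs_op_emp_process:
  assumes \<G>: "\<G> \<subseteq> BV_rc T" and n: "n > 0"
    and F: "\<And>s t. s \<le> t \<Longrightarrow> F s \<le> F t" "\<And>t. continuous (at_right t) F" "\<And>t. \<bar>F t\<bar> \<le> 1"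
  shows "rs_op \<G> (emp_process n F x) = emp_integral \<G> n F x"
proof (rule ext)
  fix g show "rs_op \<G> (emp_process n F x) g = emp_integral \<G> n F x g"
  proof (cases "g \<in> \<G>")
    case True
    then have g: "rc_bounded T g" using \<G> BV_rc_rc_bounded by auto
    have "emp_process n F x = (\<lambda>t. sqrt n * (ecdf n x t - F t))"
      using emp_process_eq[OF n] by (rule ext)
    then have "rs_sum k (emp_process n F x) g = sqrt n * (rs_sum k (ecdf n x) g - rs_sum k F g)" for k
      by (simp only: rs_sum_cmult_left rs_sum_diff_left)
    moreover have "(\<lambda>k. sqrt n * (rs_sum k (ecdf n x) g - rs_sum k F g)) \<longlonglongrightarrow>
        sqrt n * (ls_integral (ecdf n x) g - ls_integral F g)"
      by (intro tendsto_intros rs_sum_LIMSEQ_ecdf[OF n g] rs_sum_LIMSEQ_interval_measure[OF F g])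
    ultimately have "(\<lambda>k. rs_sum k (emp_process n F x) g) \<longlonglongrightarrow>
        sqrt n * (ls_integral (ecdf n x) g - ls_integral F g)" by simp
    from rs_op_eqI[OF True this] show ?thesis using True by (simp add: emp_integral_def)
  qed (simp add: rs_op_def emp_integral_def)
qed

lemma tends_to_0_in_outer_prob_mono:
  assumes D: "tends_to_0_in_outer_prob M D" and C: "C > 0"
    and le: "\<And>n \<omega>. n \<ge> 1 \<Longrightarrow> \<omega> \<in> space M \<Longrightarrow> \<bar>E n \<omega>\<bar> \<le> C * \<bar>D n \<omega>\<bar>"
  shows "tends_to_0_in_outer_prob M E"
  unfolding tends_to_0_in_outer_prob_def
proof (intro allI impI)
  fix \<epsilon> :: real assume "\<epsilon> > 0"
  then have lim: "(\<lambda>n. outer_measure_of M {\<omega> \<in> space M. \<bar>D n \<omega>\<bar> > \<epsilon> / C}) \<longlonglongrightarrow> 0"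
    using D C unfolding tends_to_0_in_outer_prob_def by simp
  have "outer_measure_of M {\<omega> \<in> space M. \<bar>E n \<omega>\<bar> > \<epsilon>} \<le>
      outer_measure_of M {\<omega> \<in> space M. \<bar>D n \<omega>\<bar> > \<epsilon> / C}" if "n \<ge> 1" for n
  proof (rule outer_measure_of_mono, safe)
    fix \<omega> assume "\<omega> \<in> space M" "\<epsilon> < \<bar>E n \<omega>\<bar>"
    with le[OF that this(1)] have "\<epsilon> < C * \<bar>D n \<omega>\<bar>" by linarith
    then show "\<epsilon> / C < \<bar>D n \<omega>\<bar>" using C by (simp add: pos_divide_less_eq mult.commute)
  qed
  then show "(\<lambda>n. outer_measure_of M {\<omega> \<in> space M. \<bar>E n \<omega>\<bar> > \<epsilon>}) \<longlonglongrightarrow> 0"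
    by (intro tendsto_sandwich[OF _ _ tendsto_const lim])
       (auto intro!: always_eventually eventually_sequentiallyI[of 1])
qed

theorem theorem6:
  fixes M :: "'a measure"
    and X :: "nat \<Rightarrow> 'a \<Rightarrow> real"
    and F :: "real \<Rightarrow> real"
    and m :: "nat \<Rightarrow> nat"
    and Xs :: "nat \<Rightarrow> nat \<Rightarrow> 'a \<Rightarrow> real"
    and \<kappa> :: "nat \<Rightarrow> (nat \<Rightarrow> real) \<Rightarrow> (nat \<Rightarrow> real) measure"
    and T :: real
    and \<G> :: "(real \<Rightarrow> real) set"
    and N :: "'b measure"
    and Y :: "'b \<Rightarrow> real \<Rightarrow> real"
  defines "D \<equiv> \<lambda>n \<omega>. d_BL UNIV (\<kappa> n (sample X n \<omega>)) (boot_process n (m n) (sample X n \<omega>)) N Y"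
  assumes M: "prob_space M"
    and X: "stationary_sequence M X"
    and F: "F = cdf (distr M borel (X 1))"
    and m: "\<And>n. n \<ge> 1 \<Longrightarrow> m n \<ge> 1"
    and Xs: "\<And>n i. n \<ge> 1 \<Longrightarrow> i \<in> {1..m n} \<Longrightarrow> Xs n i \<in> borel_measurable M"
    and \<kappa>: "\<And>n. n \<ge> 1 \<Longrightarrow>
          regular_cond_distr M (Pi\<^sub>M {1..n} (\<lambda>_. borel)) (Pi\<^sub>M {1..m n} (\<lambda>_. borel))
            (sample X n) (sample (Xs n) (m n)) (\<kappa> n)"
    and T: "T > 0"
    and \<G>: "\<G> \<subseteq> BV_rc T"
    and Y: "uc_gaussian_process UNIV (\<lambda>s t. \<bar>F s - F t\<bar>) N Y"
    and boot: "tends_to_0_in_outer_prob M D"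
  shows "\<exists>(N' :: 'b measure) Z.
      uc_gaussian_process \<G> (\<lambda>f g. ls_integral F (\<lambda>x. \<bar>f x - g x\<bar>)) N' Z \<and>
      (let E = (\<lambda>n \<omega>. d_BL \<G> (\<kappa> n (sample X n \<omega>)) (boot_integral \<G> n (m n) (sample X n \<omega>)) N' Z)
       in tends_to_0_in_outer_prob M E \<and>
          ((AE \<omega> in M. (\<lambda>n. D n \<omega>) \<longlonglongrightarrow> 0) \<longrightarrow> (AE \<omega> in M. (\<lambda>n. E n \<omega>) \<longlonglongrightarrow> 0)) \<and>
          (weakly_converges UNIV M (\<lambda>n \<omega>. emp_process n F (sample X n \<omega>)) N Y \<longrightarrow>
             weakly_converges \<G> M (\<lambda>n \<omega>. emp_integral \<G> n F (sample X n \<omega>)) N' Z \<and>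
             tends_to_0_in_outer_prob M E))"
proof -
  \<comment> \<open>The limit lives on the same space as \<open>Y\<close>, so \<open>N\<close> is
    the witness for \<open>N'\<close>.\<close>
  define Z where "Z \<omega> = rs_op \<G> (Y \<omega>)" for \<omega>
  define E where "E n \<omega> = d_BL \<G> (\<kappa> n (sample X n \<omega>)) (boot_integral \<G> n (m n) (sample X n \<omega>)) N Z"
    for n \<omega>
  \<comment> \<open>A Lipschitz constant of \<open>rs_op \<G>\<close>, raised to 1 as
    \<open>d_BL_Lipschitz_map\<close> demands.\<close>
  define C where "C = max 1 (3 * T)"
  have T0: "T \<ge> 0" using T by simp
  interpret M: prob_space M by (rule M)
  have X1: "X 1 \<in> borel_measurable M" using X by (simp add: stationary_sequence_def)
  interpret P: real_distribution "distr M borel (X 1)"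
    using X1 by (rule M.real_distribution_distr)
  have mono: "\<And>s t. s \<le> t \<Longrightarrow> F s \<le> F t" unfolding F by (rule P.cdf_nondecreasing)
  have rc: "\<And>t. continuous (at_right t) F" unfolding F by (rule P.cdf_is_right_cont)
  have F1: "\<And>t. \<bar>F t\<bar> \<le> 1" unfolding F using P.cdf_nonneg P.cdf_bounded_prob by simp
  have N: "prob_space N" and Ym: "Y \<in> N \<rightarrow>\<^sub>M linf_borel UNIV"
    using Y by (auto simp: uc_gaussian_process_def)
  have Ysp: "Y \<omega> \<in> mspace (linf UNIV)" if "\<omega> \<in> space N" for \<omega>
    using measurable_space[OF Ym that] by simp
  \<comment> \<open>Holds for every \<open>\<omega>\<close>, since \<open>sample\<close> always
    lands in the product space on which the kernel is defined.\<close>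
  have K: "prob_space (\<kappa> n (sample X n \<omega>))" if "n \<ge> 1" for n \<omega>
  proof -
    have "\<kappa> n \<in> Pi\<^sub>M {1..n} (\<lambda>_. borel) \<rightarrow>\<^sub>M prob_algebra (Pi\<^sub>M {1..m n} (\<lambda>_. borel))"
      using \<kappa>[OF that] by (simp add: regular_cond_distr_def)
    moreover have "sample X n \<omega> \<in> space (Pi\<^sub>M {1..n} (\<lambda>_. borel))"
      by (auto simp: sample_def space_PiM)
    ultimately have "\<kappa> n (sample X n \<omega>) \<in> space (prob_algebra (Pi\<^sub>M {1..m n} (\<lambda>_. borel)))"
      by (rule measurable_space)
    then show ?thesis by (simp add: space_prob_algebra)
  qed
  \<comment> \<open>This pathwise comparison gives convergence in outer probability and almost
    surely alike.\<close>
  have E_le: "\<bar>E n \<omega>\<bar> \<le> C * \<bar>D n \<omega>\<bar>" if n: "n \<ge> 1" for n \<omega>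
  proof -
    have op: "boot_integral \<G> n (m n) (sample X n \<omega>) =
        (\<lambda>y. rs_op \<G> (boot_process n (m n) (sample X n \<omega>) y))"
      using rs_op_boot_process[OF \<G>] n m[OF n] by auto
    have "E n \<omega> \<le> C * D n \<omega>"
      unfolding E_def D_def op Z_def[abs_def]
    proof (rule d_BL_Lipschitz_map[OF K[OF n] N boot_process_mspace Ysp rs_op_mspace[OF T0 \<G>]])
      fix z w :: "real \<Rightarrow> real" assume "z \<in> mspace (linf UNIV)" "w \<in> mspace (linf UNIV)"
      note rs_op_Lipschitz[OF T0 \<G> this]
      also have "3 * T * mdist (linf UNIV) z w \<le> C * mdist (linf UNIV) z w"
        by (intro mult_right_mono) (auto simp: C_def)
      finally show "mdist (linf \<G>) (rs_op \<G> z) (rs_op \<G> w) \<le> C * mdist (linf UNIV) z w" .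
    qed (auto simp: C_def)
    moreover have "0 \<le> E n \<omega>"
      unfolding E_def op Z_def[abs_def]
      by (intro d_BL_nonneg K[OF n] N rs_op_mspace[OF T0 \<G>] boot_process_mspace Ysp)
    moreover have "C * D n \<omega> \<le> C * \<bar>D n \<omega>\<bar>" by (intro mult_left_mono) (auto simp: C_def)
    ultimately show ?thesis by linarith
  qed
  have E_prob: "tends_to_0_in_outer_prob M E"
    by (rule tends_to_0_in_outer_prob_mono[OF boot _ E_le]) (auto simp: C_def)
  have E_AE: "AE \<omega> in M. (\<lambda>n. E n \<omega>) \<longlonglongrightarrow> 0" if "AE \<omega> in M. (\<lambda>n. D n \<omega>) \<longlonglongrightarrow> 0"
    using that
  proof eventually_elim
    fix \<omega> assume "(\<lambda>n. D n \<omega>) \<longlonglongrightarrow> 0"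
    then have "(\<lambda>n. C * \<bar>D n \<omega>\<bar>) \<longlonglongrightarrow> 0"
      by (intro tendsto_mult_right_zero tendsto_rabs_zero)
    then show "(\<lambda>n. E n \<omega>) \<longlonglongrightarrow> 0"
      by (rule Lim_null_comparison[rotated]) (use E_le in \<open>auto intro!: eventually_sequentiallyI[of 1]\<close>)
  qed
  have E_weak: "weakly_converges \<G> M (\<lambda>n \<omega>. emp_integral \<G> n F (sample X n \<omega>)) N Z"
    if wc: "weakly_converges UNIV M (\<lambda>n \<omega>. emp_process n F (sample X n \<omega>)) N Y"
    unfolding weakly_converges_def
  proof (intro allI impI, elim conjE)
    fix h assume h: "continuous_map (mtopology_of (linf \<G>)) euclideanreal h" "bounded (h ` mspace (linf \<G>))"
    \<comment> \<open>Continuous mapping: this is again a bounded continuous test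
      functional.\<close>
    let ?h = "h \<circ> rs_op \<G>"
    have "continuous_map (mtopology_of (linf UNIV)) euclideanreal ?h"
      by (rule continuous_map_compose[OF continuous_map_rs_op[OF T0 \<G>] h(1)])
    moreover have "bounded (?h ` mspace (linf UNIV))"
      by (rule bounded_subset[OF h(2)]) (use rs_op_mspace[OF T0 \<G>] in auto)
    ultimately have "(\<lambda>n. outer_expectation M (\<lambda>\<omega>. ?h (emp_process n F (sample X n \<omega>))))
        \<longlonglongrightarrow> (LINT \<omega>|N. ?h (Y \<omega>))"
      using wc unfolding weakly_converges_def by blast
    \<comment> \<open>The processes correspond under the operator for \<open>n \<ge> 1\<close>,
      which suffices for the limit.\<close>
    moreover have "\<forall>\<^sub>F n in sequentially. outer_expectation M (\<lambda>\<omega>. ?h (emp_process n F (sample X n \<omega>))) =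
        outer_expectation M (\<lambda>\<omega>. h (emp_integral \<G> n F (sample X n \<omega>)))"
      by (rule eventually_sequentiallyI[of 1]) (simp add: rs_op_emp_process[OF \<G> _ mono rc F1])
    ultimately show "(\<lambda>n. outer_expectation M (\<lambda>\<omega>. h (emp_integral \<G> n F (sample X n \<omega>))))
        \<longlonglongrightarrow> (LINT \<omega>|N. h (Z \<omega>))"
      by (simp add: Z_def Lim_transform_eventually)
  qed
  have "uc_gaussian_process \<G> (\<lambda>f g. ls_integral F (\<lambda>x. \<bar>f x - g x\<bar>)) N Z"
    unfolding Z_def[abs_def] by (rule uc_gaussian_process_rs_op[OF mono rc F1 Y T \<G>])
  then show ?thesis
    using E_prob E_AE E_weak unfolding Let_def E_def[abs_def] by blast
qed

end
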